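(* Let $E$ be the elliptic curve $Y^2 = (X^2 + 1)(X + 1 - i)$ over $\mathbb{Q}(i)$. Let $f_{2,i}(z) = z^2 + i$ and, for $m \geq 0$, let $K_m := \mathbb{Q}(i)\big(f_{2,i}^{-m}(0)\big) \subset \overline{\mathbb{Q}}$ be the splitting field over $\mathbb{Q}(i)$ of the $m$-th iterate $f_{2,i}^m$. For every integer $m \geq 3$, $$\operatorname{rank} E(K_m) \geq \frac{m \log 2 - \log(256 \cdot 10^{13})}{2\log\left(1 + \frac{5}{4\sqrt{2}}\right)}.$$
   Context: $i = \sqrt{-1}$. $f_{2,i}^m$ denotes the $m$-fold composition of $f_{2,i}$ with itself ($f_{2,i}^0(z) = z$), and $f_{2,i}^{-m}(0)$ is the set of its roots in $\overline{\mathbb{Q}}$. $\log$ is the natural logarithm. *)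

theory Defs
  imports
    Complex_Main
    "HOL-Algebra.Generated_Fields"
    "HOL-Algebra.Algebraic_Closure_Type"
    "HOL-Computational_Algebra.Polynomial"
    "HOL-Library.Extended_Real"
begin

section \<open>Elliptic curves \<open>Y\<^sup>2 = f(X)\<close>\<close>

text \<open>
  Here \<open>f\<close> is a separable monic cubic over a field of characteristic different from 2.
  A point of the projective curve is either an affine point or the single point at infinity.
\<close>

datatype 'a ec_point = Infinity | Affine 'a 'a

text \<open>
  Chord-tangent addition. Substituting the line of slope \<open>l\<close> through the two points into
  \<open>Y\<^sup>2 = X\<^sup>3 + a X\<^sup>2 + b X + c\<close> gives a cubic in \<open>X\<close> whose three roots sum to \<open>l\<^sup>2 - a\<close>. The
  third intersection point is then reflected in the \<open>X\<close>-axis. In the tangent case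
  the two points lie on the curve and are not mutually inverse, so they are equal with
  \<open>y1 \<noteq> 0\<close>. The function is meaningful only for points of the curve.
\<close>

fun ec_add :: "'a::field poly \<Rightarrow> 'a ec_point \<Rightarrow> 'a ec_point \<Rightarrow> 'a ec_point" where
  "ec_add f Infinity Q = Q"
| "ec_add f P Infinity = P"
| "ec_add f (Affine x1 y1) (Affine x2 y2) =
     (if x1 = x2 \<and> y1 = - y2 then Infinity
      else
        let l = (if x1 = x2 then poly (pderiv f) x1 / (2 * y1) else (y2 - y1) / (x2 - x1));
            x3 = l ^ 2 - Polynomial.coeff f 2 - x1 - x2
        in Affine x3 (l * (x1 - x3) - y1))"

text \<open>
  The group \<open>E(K)\<close> of points of \<open>Y\<^sup>2 = f(X)\<close> with coordinates in a subfield \<open>K\<close> of the ambient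
  field, where \<open>K\<close> contains the coefficients of \<open>f\<close>.
\<close>

definition ec_group :: "'a::field poly \<Rightarrow> 'a set \<Rightarrow> 'a ec_point monoid" where
  "ec_group f K =
     \<lparr> carrier = insert Infinity {Affine x y | x y. x \<in> K \<and> y \<in> K \<and> y ^ 2 = poly f x},
       monoid.mult = ec_add f, monoid.one = Infinity \<rparr>"


section \<open>The rank of an abelian group\<close>

definition int_independent :: "('a, 'b) monoid_scheme \<Rightarrow> 'a set \<Rightarrow> bool" where
  "int_independent G S \<longleftrightarrow>
     (\<forall>c :: 'a \<Rightarrow> int.
        (\<Otimes>\<^bsub>G\<^esub>P\<in>S. P [^]\<^bsub>G\<^esub> c P) = \<one>\<^bsub>G\<^esub> \<longrightarrow> (\<forall>P\<in>S. c P = 0))"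

text \<open>
  The rank is the supremum of the sizes of finite \<open>\<int>\<close>-linearly independent subsets, i.e. the
  dimension of \<open>G \<otimes> \<rat>\<close>. It takes values in \<^typ>\<open>enat\<close>, so that no finiteness
  assumption is needed. For a finitely generated group it is the usual rank.
\<close>

definition abelian_rank :: "('a, 'b) monoid_scheme \<Rightarrow> enat" where
  "abelian_rank G =
     Sup {enat (card S) | S. finite S \<and> S \<subseteq> carrier G \<and> int_independent G S}"


section \<open>The curve and the tower of fields\<close>

definition cubic_E :: "complex poly" where
  "cubic_E = ([:0, 1:] ^ 2 + 1) * ([:0, 1:] + 1 - [:\<i>:])"

definition f2i :: "complex \<Rightarrow> complex" where
  "f2i z = z ^ 2 + \<i>"

definition adjoin :: "complex set \<Rightarrow> complex set \<Rightarrow> complex set" where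
  "adjoin F S = generate_field ring_of_type_algebra (F \<union> S)"

definition Qi :: "complex set" where
  "Qi = adjoin \<rat> {\<i>}"

text \<open>
  The field \<open>\<rat>\<close>-bar is realised as the algebraic numbers in \<^typ>\<open>complex\<close>. All complex
  roots of the iterates are algebraic (lemma \<open>iterate_root_algebraic\<close> below).
\<close>

definition iterate_roots :: "nat \<Rightarrow> complex set" where
  "iterate_roots m = {z. (f2i ^^ m) z = 0}"

definition splitK :: "nat \<Rightarrow> complex set" where
  "splitK m = adjoin Qi (iterate_roots m)"


section \<open>Nonsingularity of the curve and algebraicity of the roots\<close>

lemma cubic_E_coeffs: "cubic_E = [:1 - \<i>, 1, 1 - \<i>, 1:]"
  by (simp add: cubic_E_def power2_eq_square one_pCons)

lemma cubic_E_separable: "poly cubic_E x = 0 \<Longrightarrow> poly (pderiv cubic_E) x \<noteq> 0"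
proof -
  assume *: "poly cubic_E x = 0"
  have "poly cubic_E x = (x - \<i>) * (x + \<i>) * (x + 1 - \<i>)"
    by (simp add: cubic_E_coeffs algebra_simps)
  with * have "x - \<i> = 0 \<or> x + \<i> = 0 \<or> x + 1 - \<i> = 0"
    by (simp only: mult_eq_0_iff) blast
  then consider "x = \<i>" | "x = - \<i>" | "x = \<i> - 1"
    by (metis add_diff_eq add_eq_0_iff2 diff_add_cancel diff_eq_eq right_minus_eq)
  then show ?thesis
    by cases (simp_all add: cubic_E_coeffs pderiv_pCons complex_eq_iff)
qed

lemma iterate_at_0: "m > 0 \<Longrightarrow> (f2i ^^ m) 0 \<in> {\<i>, \<i> - 1, - \<i>}"
proof (induction m)
  case (Suc m)
  then have "m = 0 \<or> (f2i ^^ m) 0 \<in> {\<i>, \<i> - 1, - \<i>}"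
    by blast
  moreover have "f2i 0 = \<i>" "f2i \<i> = \<i> - 1" "f2i (\<i> - 1) = - \<i>" "f2i (- \<i>) = \<i> - 1"
    by (simp_all add: f2i_def power2_eq_square algebra_simps)
  ultimately show ?case
    by auto
qed simp

definition int_coeffs :: "complex poly \<Rightarrow> bool" where
  "int_coeffs p \<longleftrightarrow> (\<forall>i. Polynomial.coeff p i \<in> \<int>)"

lemma int_coeffs_mult: "int_coeffs p \<Longrightarrow> int_coeffs q \<Longrightarrow> int_coeffs (p * q)"
  by (auto simp: int_coeffs_def coeff_mult intro!: Ints_sum Ints_mult)

lemma int_coeffs_add: "int_coeffs p \<Longrightarrow> int_coeffs q \<Longrightarrow> int_coeffs (p + q)"
  by (auto simp: int_coeffs_def)

lemma int_coeffs_diff: "int_coeffs p \<Longrightarrow> int_coeffs q \<Longrightarrow> int_coeffs (p - q)"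
  by (auto simp: int_coeffs_def)

lemma iterate_root_algebraic:
  assumes "(f2i ^^ m) z = 0"
  shows "algebraic z"
proof (cases "m = 0")
  case True
  then show ?thesis using assms by simp
next
  case False
  have "\<exists>A B. int_coeffs A \<and> int_coeffs B \<and> (\<forall>w. (f2i ^^ m) w = poly A w + \<i> * poly B w)"
  proof (induction m)
    case 0
    show ?case
      by (rule exI[of _ "[:0, 1:]"], rule exI[of _ 0])
         (auto simp: int_coeffs_def coeff_pCons split: nat.splits)
  next
    case (Suc m)
    then obtain A B where AB: "int_coeffs A" "int_coeffs B"
      and *: "\<And>w. (f2i ^^ m) w = poly A w + \<i> * poly B w"
      by blast
    have "int_coeffs 1"
      by (auto simp: int_coeffs_def coeff_1)
    with AB have "int_coeffs (A * A - B * B)" "int_coeffs (A * B + A * B + 1)"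
      by (blast intro: int_coeffs_mult int_coeffs_add int_coeffs_diff)+
    moreover have "(f2i ^^ Suc m) w = poly (A * A - B * B) w + \<i> * poly (A * B + A * B + 1) w" for w
    proof -
      have "(f2i ^^ Suc m) w = (poly A w + \<i> * poly B w) * (poly A w + \<i> * poly B w) + \<i>"
        by (simp add: * f2i_def power2_eq_square)
      then show ?thesis
        by (simp add: algebra_simps)
    qed
    ultimately show ?case by blast
  qed
  then obtain A B where AB: "int_coeffs A" "int_coeffs B"
    and *: "\<And>w. (f2i ^^ m) w = poly A w + \<i> * poly B w"
    by blast
  define N where "N = A * A + B * B"
  have "poly N z = (poly A z + \<i> * poly B z) * (poly A z - \<i> * poly B z)"
    by (simp add: N_def algebra_simps)
  also have "\<dots> = 0"
    using assms * by simp
  finally have root: "poly N z = 0" .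
  have "N \<noteq> 0"
  proof
    assume "N = 0"
    obtain a b where ab: "poly A 0 = of_int a" "poly B 0 = of_int b"
      using AB unfolding int_coeffs_def poly_0_coeff_0 by (metis Ints_cases)
    from \<open>N = 0\<close> have "poly N 0 = 0" by simp
    then have "of_int (a * a + b * b) = (0 :: complex)"
      by (simp add: N_def ab)
    then have "a * a + b * b = 0"
      by (simp only: of_int_eq_0_iff)
    then have "a = 0 \<and> b = 0"
      by (simp add: sum_squares_eq_zero_iff)
    then have "(f2i ^^ m) 0 = 0"
      by (simp add: * ab)
    with iterate_at_0[of m] False show False
      by (auto simp: complex_eq_iff)
  qed
  moreover have "int_coeffs N"
    unfolding N_def using AB by (intro int_coeffs_add int_coeffs_mult)
  ultimately show ?thesis
    using root by (intro algebraicI[of N]) (auto simp: int_coeffs_def)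
qed

end

theory Submission
  imports Defs
begin

text \<open>
  The nonzero part of the critical orbit \<open>0 \<mapsto> i \<mapsto> i - 1 \<mapsto> -i \<mapsto> i - 1\<close> of \<open>z\<^sup>2 + i\<close> is the set of roots of the
  cubic. For an \<open>n\<close>-th preimage \<open>\<beta>\<close> of \<open>0\<close>, \<open>n > 0\<close>, this makes \<open>\<beta> - e\<close> a square in \<open>K\<^sub>n\<^sub>+\<^sub>2\<close> for each root \<open>e\<close>
  (lemma \<open>square_root_cubic_E_in_splitK\<close>). So \<open>\<beta>\<close> is the \<open>X\<close>-coordinate of a point of \<open>E(K\<^sub>n\<^sub>+\<^sub>2)\<close>.
  Choose \<open>\<beta>\<^sub>n\<close> with \<open>\<beta>\<^sub>n\<^sub>+\<^sub>1\<^sup>2 = \<beta>\<^sub>n - i\<close> and let \<open>P\<^sub>n\<close> be a point above \<open>\<beta>\<^sub>n\<close>. The points \<open>2 P\<^sub>n\<close> with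
  \<open>2 \<le> n \<le> m - 2\<close> turn out to be linearly independent. Hence \<open>E(K\<^sub>m)\<close> has rank at least \<open>m - 3\<close>, which exceeds
  the claimed bound because that one starts lower and grows with slope \<open>ln 2 / (2 ln 1.88...) < 1\<close>.

  Independence is a 2-adic fact. Extend the 2-adic valuation \<open>v\<close> to the complex numbers and say that a point with
  \<open>v(X) < 0\<close> has depth \<open>- v(X)\<close>. In the formal group of the curve two points of different depths add up to a point of
  the smaller depth, and doubling increases the depth by \<open>v(4)\<close> (lemmas \<open>has_depth_add\<close>, \<open>has_depth_double\<close>). So a
  nonzero multiple of a point of depth \<open>d\<close> has depth \<open>d + e v(4)\<close> for some \<open>e \<ge> 0\<close>. If the depths of finitely many
  points are pairwise different modulo \<open>v(4)\<close>, then the terms of a nontrivial combination have different depths, and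
  the combination has a depth too and is not the neutral element (lemma \<open>int_independentI\<close>).

  It remains to compute depths. The fields generated over \<open>\<rat>(i)\<close> by the \<open>\<beta>\<^sub>n\<close> are totally ramified at \<open>2\<close>: with \<open>v(2) = 1\<close> one has
  \<open>v(\<beta>\<^sub>2\<^sub>k) = 1 / (2 * 4\<^sup>k)\<close> (lemma \<open>eps_sim_pi\<close>). The duplication formula gives the depths
  \<open>2 \<plusminus> 1 / (2 * 4\<^sup>k)\<close> for \<open>2 P\<^sub>2\<^sub>k\<close> and \<open>2 P\<^sub>2\<^sub>k\<^sub>+\<^sub>1\<close>, and all of these differ modulo \<open>v(4) = 2\<close>.

  Two general facts carry this argument. The chord-tangent law is a commutative group law (lemma
  \<open>comm_group_ec_group\<close>), proved by computing with Vieta's formulas for the lines involved. The valuation is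
  replaced by a valuation ring of the complex numbers in which \<open>2\<close> is not a unit (lemma \<open>exists_valuation_ring\<close>);
  comparing sizes only needs divisibility in that ring.
\<close>

section \<open>Subfields\<close>

lemma inv_ring_of_type_algebra:
  assumes "x \<noteq> (0 :: 'a :: field)"
  shows "inv\<^bsub>ring_of_type_algebra\<^esub> x = inverse x"
proof -
  interpret F: Ring.field "ring_of_type_algebra :: 'a ring"
    by (rule field_from_type_algebra)
  show ?thesis
    using assms by (intro F.comm_inv_char) (auto simp: ring_of_type_algebra_def)
qed

lemma subfield_closed:
  fixes K :: "'a :: field set"
  assumes "subfield K ring_of_type_algebra"
  shows "1 \<in> K" "x \<in> K \<Longrightarrow> y \<in> K \<Longrightarrow> x + y \<in> K" "x \<in> K \<Longrightarrow> y \<in> K \<Longrightarrow> x * y \<in> K"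
    "x \<in> K \<Longrightarrow> y \<in> K \<Longrightarrow> x - y \<in> K" "x \<in> K \<Longrightarrow> - x \<in> K" "x \<in> K \<Longrightarrow> y \<in> K \<Longrightarrow> x / y \<in> K"
proof -
  let ?F = "ring_of_type_algebra :: 'a ring"
  interpret F: Ring.field ?F
    by (rule field_from_type_algebra)
  note sub = subringE[OF subfieldE(1)[OF assms]]
  show "1 \<in> K" using sub(3) by (simp add: ring_of_type_algebra_def)
  show add: "x + y \<in> K" if "x \<in> K" "y \<in> K" for x y
    using sub(7)[OF that] by (simp add: ring_of_type_algebra_def)
  show mult: "x * y \<in> K" if "x \<in> K" "y \<in> K" for x y
    using sub(6)[OF that] by (simp add: ring_of_type_algebra_def)
  have "\<ominus>\<^bsub>?F\<^esub> x = - x" for x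
    by (intro F.minus_equality) (auto simp: ring_of_type_algebra_def)
  then show uminus: "- x \<in> K" if "x \<in> K" for x
    using sub(5)[OF that] by simp
  have inverse: "inverse x \<in> K" if "x \<in> K" for x
  proof (cases "x = 0")
    case False
    then show ?thesis
      using F.subfield_m_inv(1)[OF assms, of x] that inv_ring_of_type_algebra[of x]
      by (simp add: ring_of_type_algebra_def)
  qed (use that in auto)
  show "x - y \<in> K" if "x \<in> K" "y \<in> K" for x y
    using add[OF that(1) uminus[OF that(2)]] by simp
  show "x / y \<in> K" if "x \<in> K" "y \<in> K" for x y
    using mult[OF that(1) inverse[OF that(2)]] by (simp add: field_class.field_divide_inverse)
qed

lemma adjoin_subfield:
  "subfield (adjoin F S) ring_of_type_algebra" "F \<union> S \<subseteq> adjoin F S"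
proof -
  interpret R: Ring.field "ring_of_type_algebra :: complex ring"
    by (rule field_from_type_algebra)
  show "subfield (adjoin F S) ring_of_type_algebra"
    unfolding adjoin_def by (rule R.generate_field_is_subfield) (simp add: ring_of_type_algebra_def)
  show "F \<union> S \<subseteq> adjoin F S"
    unfolding adjoin_def by (auto intro: generate_field.incl)
qed

section \<open>The chord-tangent group law\<close>

fun ec_neg :: "'a::field ec_point \<Rightarrow> 'a ec_point" where
  "ec_neg Infinity = Infinity"
| "ec_neg (Affine x y) = Affine x (- y)"

text \<open>
  Algebraic closure is what makes the curve have infinitely many points: every \<open>X\<close>-coordinate occurs.
  The proof of associativity moves away from degenerate configurations with their help.
\<close>

locale monic_separable_cubic =
  fixes a b c :: "'a :: {alg_closed_field, field_char_0}" and f :: "'a poly"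
  assumes f_def: "f = [:c, b, a, 1:]"
    and separable: "poly f x = 0 \<Longrightarrow> poly (pderiv f) x \<noteq> 0"
begin

abbreviation points :: "'a ec_point set" where
  "points \<equiv> carrier (ec_group f UNIV)"

text \<open>
  These are Vieta's formulas for the cubic \<open>f(X) - (l X + k)\<^sup>2\<close>: the line \<open>Y = l X + k\<close> meets the curve
  in the points with \<open>X\<close>-coordinates \<open>x1, x2, x3\<close>, counted with multiplicity. Tangents are the case of
  a repeated \<open>X\<close>-coordinate, which lets chords and tangents be treated together.
\<close>

definition collinear :: "'a \<Rightarrow> 'a \<Rightarrow> 'a \<Rightarrow> 'a \<Rightarrow> 'a \<Rightarrow> bool" where
  "collinear l k x1 x2 x3 \<longleftrightarrow>
     x1 + x2 + x3 = l ^ 2 - a \<and> x1 * x2 + x1 * x3 + x2 * x3 = b - 2 * l * k \<and>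
     x1 * x2 * x3 = k ^ 2 - c"

lemma poly_f: "poly f x = x ^ 3 + a * x ^ 2 + b * x + c"
  by (simp add: f_def algebra_simps power2_eq_square power3_eq_cube)

lemma poly_pderiv_f: "poly (pderiv f) x = 3 * x ^ 2 + 2 * a * x + b"
  by (simp add: f_def pderiv_pCons algebra_simps power2_eq_square)

lemma coeff_f_2: "Polynomial.coeff f 2 = a"
  by (simp add: f_def eval_nat_numeral)

lemma Affine_in_points [simp]: "Affine x y \<in> points \<longleftrightarrow> y ^ 2 = poly f x"
  by (auto simp: ec_group_def)

lemma Infinity_in_points [simp]: "Infinity \<in> points"
  by (auto simp: ec_group_def)

lemma points_same_x:
  assumes "Affine x y \<in> points" "Affine x z \<in> points"
  shows "z = y \<or> z = - y"
  using assms by (metis Affine_in_points power2_eq_iff)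

lemma ec_neg_in_points [simp]: "ec_neg P \<in> points \<longleftrightarrow> P \<in> points"
  by (cases P) auto

lemma ec_neg_ec_neg [simp]: "ec_neg (ec_neg P) = P"
  by (cases P) auto

lemma collinear_perm:
  assumes "collinear l k x1 x2 x3"
  shows "collinear l k x2 x1 x3" "collinear l k x1 x3 x2" "collinear l k x3 x2 x1"
  using assms by (auto simp: collinear_def algebra_simps)

lemma collinear_uminus: "collinear l k x1 x2 x3 \<Longrightarrow> collinear (- l) (- k) x1 x2 x3"
  by (auto simp: collinear_def)

lemma collinear_factor:
  assumes "collinear l k x1 x2 x3"
  shows "poly f x - (l * x + k) ^ 2 = (x - x1) * (x - x2) * (x - x3)"
proof -
  have *: "a = l ^ 2 - (x1 + x2 + x3)" "b = x1 * x2 + x1 * x3 + x2 * x3 + 2 * l * k"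
    "c = k ^ 2 - x1 * x2 * x3"
    using assms by (auto simp: collinear_def algebra_simps)
  show ?thesis
    unfolding poly_f * by (simp add: algebra_simps power2_eq_square power3_eq_cube)
qed

lemma collinear_on_curve:
  assumes "collinear l k x1 x2 x3" "x \<in> {x1, x2, x3}"
  shows "(l * x + k) ^ 2 = poly f x"
  using collinear_factor[OF assms(1), of x] assms(2) by auto

lemma collinear_double:
  assumes "collinear l k x x x3"
  shows "poly (pderiv f) x = 2 * l * (l * x + k)"
proof -
  have *: "a = l ^ 2 - (x + x + x3)" "b = x * x + x * x3 + x * x3 + 2 * l * k"
    using assms by (auto simp: collinear_def algebra_simps)
  show ?thesis
    unfolding poly_pderiv_f * by (simp add: algebra_simps power2_eq_square)
qed

text \<open>
  Separability is needed when \<open>x1 = x2\<close>. If the line passed through the curve at height \<open>0\<close> there, a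
  double zero of \<open>f(X) - (l X + k)\<^sup>2\<close> would be a double zero of \<open>f\<close>. So the point is not its own
  inverse and \<open>l\<close> is the tangent slope used by \<^const>\<open>ec_add\<close>.
\<close>

lemma ec_add_collinear:
  assumes "collinear l k x1 x2 x3"
  shows "ec_add f (Affine x1 (l * x1 + k)) (Affine x2 (l * x2 + k)) = Affine x3 (- (l * x3 + k))"
proof -
  have x3: "x3 = l ^ 2 - a - x1 - x2"
    using assms by (simp add: collinear_def algebra_simps)
  show ?thesis
  proof (cases "x1 = x2")
    case True
    have d: "poly (pderiv f) x1 = 2 * l * (l * x1 + k)"
      using collinear_double assms True by blast
    have "l * x1 + k \<noteq> 0"
    proof
      assume 0: "l * x1 + k = 0"
      then have "poly f x1 = 0"
        using collinear_on_curve[OF assms, of x1] by simp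
      then show False
        using separable[of x1] d 0 by simp
    qed
    then have "l * x1 + k \<noteq> - (l * x1 + k)"
      by (metis add_eq_0_iff2 mult_2 mult_eq_0_iff zero_neq_numeral)
    moreover have "poly (pderiv f) x1 / (2 * (l * x1 + k)) = l"
      unfolding d using \<open>l * x1 + k \<noteq> 0\<close> by (simp del: distrib_left_numeral)
    ultimately show ?thesis
      using True by (simp add: Let_def coeff_f_2 x3[folded True, symmetric] algebra_simps del: minus_add_distrib)
        (simp add: x3 algebra_simps)
  next
    case False
    then have "(l * x2 + k - (l * x1 + k)) / (x2 - x1) = l"
      by (simp add: field_simps)
    with False show ?thesis
      by (simp add: Let_def coeff_f_2 x3) (simp add: algebra_simps)
  qed
qed

lemma collinear_exists:
  assumes "y1 ^ 2 = poly f x1" "y2 ^ 2 = poly f x2" "\<not> (x1 = x2 \<and> y1 = - y2)"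
  obtains l k x3 where "y1 = l * x1 + k" "y2 = l * x2 + k" "collinear l k x1 x2 x3"
proof (cases "x1 = x2")
  case True
  then have "y1 ^ 2 = y2 ^ 2" using assms by simp
  then have "y1 = y2"
    using assms(3) True by (auto simp: power2_eq_iff)
  then have y: "y2 = y1" "y1 \<noteq> 0"
    using assms(3) True by auto
  define l where "l = poly (pderiv f) x1 / (2 * y1)"
  have l: "2 * l * y1 = 3 * x1 ^ 2 + 2 * a * x1 + b"
    using y by (simp add: l_def poly_pderiv_f)
  define k where "k = y1 - l * x1"
  have y1: "y1 = l * x1 + k" by (simp add: k_def)
  have 1: "(l * x1 + k) ^ 2 = x1 ^ 3 + a * x1 ^ 2 + b * x1 + c"
    using assms(1) y1 by (simp add: poly_f)
  have 2: "2 * l * (l * x1 + k) = 3 * x1 ^ 2 + 2 * a * x1 + b"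
    using l y1 by simp
  define x3 where "x3 = l ^ 2 - a - x1 - x1"
  have e2: "x1 * x1 + x1 * x3 + x1 * x3 = b - 2 * l * k"
    using 2 unfolding x3_def by Groebner_Basis.algebra
  have "x1 * x1 * x3 = k ^ 2 - c"
    using 1 2 unfolding x3_def by Groebner_Basis.algebra
  with e2 have "collinear l k x1 x2 x3"
    unfolding collinear_def True[symmetric] by (simp add: x3_def)
  with y y1 True show ?thesis by (intro that[of l k]) auto
next
  case False
  define l where "l = (y2 - y1) / (x2 - x1)"
  define k where "k = y1 - l * x1"
  have y1: "y1 = l * x1 + k" by (simp add: k_def)
  have "l * (x2 - x1) = y2 - y1" using False by (simp add: l_def)
  then have y2: "y2 = l * x2 + k" by (simp add: k_def algebra_simps)
  define x3 where "x3 = l ^ 2 - a - x1 - x2"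
  have 1: "(l * x1 + k) ^ 2 = x1 ^ 3 + a * x1 ^ 2 + b * x1 + c"
    using assms(1) y1 by (simp add: poly_f)
  have 2: "(l * x2 + k) ^ 2 = x2 ^ 3 + a * x2 ^ 2 + b * x2 + c"
    using assms(2) y2 by (simp add: poly_f)
  have "(x2 - x1) * (x1 * x2 + x1 * x3 + x2 * x3 - (b - 2 * l * k)) = 0"
    using 1 2 unfolding x3_def by Groebner_Basis.algebra
  then have e2: "x1 * x2 + x1 * x3 + x2 * x3 = b - 2 * l * k"
    using False by simp
  have "x1 * x2 * x3 = k ^ 2 - c"
    using 1 e2 unfolding x3_def by Groebner_Basis.algebra
  with e2 have "collinear l k x1 x2 x3"
    by (simp add: collinear_def) (simp add: x3_def)
  with y1 y2 show ?thesis by (rule that)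
qed

lemma ec_add_Infinity_right [simp]: "ec_add f P Infinity = P"
  by (cases P) auto

lemma ec_add_neg [simp]: "ec_add f P (ec_neg P) = Infinity" "ec_add f (ec_neg P) P = Infinity"
  by (cases P; simp)+

declare ec_add.simps(3) [simp del]

lemma ec_add_cases:
  assumes "P \<in> points" "Q \<in> points"
  obtains (Infinity_left) "P = Infinity" | (Infinity_right) "Q = Infinity"
  | (opposite) "Q = ec_neg P"
  | (line) l k x1 x2 x3 where "P = Affine x1 (l * x1 + k)" "Q = Affine x2 (l * x2 + k)"
      "collinear l k x1 x2 x3" "ec_add f P Q = Affine x3 (- (l * x3 + k))"
proof (cases P; cases Q)
  fix x1 y1 x2 y2 assume PQ: "P = Affine x1 y1" "Q = Affine x2 y2"
  show thesis
  proof (cases "x1 = x2 \<and> y1 = - y2")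
    case False
    from PQ assms obtain l k x3 where "y1 = l * x1 + k" "y2 = l * x2 + k" "collinear l k x1 x2 x3"
      using collinear_exists[of y1 x1 y2 x2] False by auto
    with line PQ ec_add_collinear show thesis by blast
  qed (use PQ opposite in auto)
qed (use Infinity_left Infinity_right in auto)

lemma ec_add_commute:
  assumes "P \<in> points" "Q \<in> points"
  shows "ec_add f P Q = ec_add f Q P"
  using assms
proof (cases rule: ec_add_cases)
  case (line l k x1 x2 x3)
  then show ?thesis
    using ec_add_collinear[OF collinear_perm(1)] by metis
qed auto

lemma ec_add_closed:
  assumes "P \<in> points" "Q \<in> points"
  shows "ec_add f P Q \<in> points"
  using assms
proof (cases rule: ec_add_cases)
  case (line l k x1 x2 x3)
  then show ?thesis
    using collinear_on_curve[OF line(3), of x3] by (simp add: power2_eq_square algebra_simps)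
qed (use assms in auto)

text \<open>
  Reflecting the line through \<open>P\<close> and \<open>Q\<close> in the \<open>X\<close>-axis gives a line through \<open>-P\<close>, \<open>P + Q\<close> and \<open>-Q\<close>.
\<close>

lemma ec_neg_add_cancel:
  assumes "P \<in> points" "Q \<in> points"
  shows "ec_add f (ec_neg P) (ec_add f P Q) = Q"
  using assms
proof (cases rule: ec_add_cases)
  case (line l k x1 x2 x3)
  have "collinear (- l) (- k) x1 x3 x2"
    using line(3) collinear_uminus collinear_perm by blast
  from ec_add_collinear[OF this] show ?thesis
    using line by simp
qed auto

text \<open>
  Let \<open>l, m\<close> be the slopes of the lines through \<open>P, Q\<close> and \<open>Q, R\<close>, and \<open>L, M\<close> those of the lines through
  \<open>P + Q, R\<close> and \<open>P, Q + R\<close>. Comparing Vieta's formulas of the first two lines, which meet in \<open>Q\<close>, gives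
  \<open>(l - m) (L + l) = x1 - x3 = (l - m) (M + m)\<close>, where \<open>x1, x3\<close> belong to \<open>P, R\<close>. Hence
  \<open>L + l = M + m\<close>, and the coordinates of both triple sums are polynomials in this common value and the
  remaining data that agree. The exclusions make \<open>L\<close> and \<open>M\<close> slopes of chords; \<open>P = Q\<close> and \<open>Q = R\<close>
  are allowed.
\<close>

lemma ec_add_assoc_generic:
  assumes pts: "P \<in> points" "Q \<in> points" "R \<in> points"
    and ne: "ec_add f P Q \<noteq> R" "ec_add f P Q \<noteq> ec_neg R"
      "ec_add f Q R \<noteq> P" "ec_add f Q R \<noteq> ec_neg P"
  shows "ec_add f (ec_add f P Q) R = ec_add f P (ec_add f Q R)"
proof -
  consider "P = Infinity" | "Q = Infinity" | "R = Infinity" | "Q = ec_neg P" | "R = ec_neg Q" | "P = R"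
    | "P \<noteq> Infinity" "Q \<noteq> Infinity" "R \<noteq> Infinity" "Q \<noteq> ec_neg P" "R \<noteq> ec_neg Q" "P \<noteq> R"
    by blast
  then show ?thesis
  proof cases
    case 4
    then show ?thesis
      using pts ec_neg_add_cancel[of "ec_neg P" R] by simp
  next
    case 5
    have "ec_add f (ec_add f P Q) (ec_neg Q) = P"
      using pts ec_neg_add_cancel[of Q P] ec_add_commute ec_add_closed ec_neg_in_points by metis
    then show ?thesis using 5 by simp
  next
    case 6
    then show ?thesis using pts ec_add_commute ec_add_closed by metis
  next
    case 7
    from pts(1,2) obtain l k x1 x2 x4 where PQ: "P = Affine x1 (l * x1 + k)" "Q = Affine x2 (l * x2 + k)"
      "collinear l k x1 x2 x4" "ec_add f P Q = Affine x4 (- (l * x4 + k))"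
      by (cases rule: ec_add_cases) (use 7 in auto)
    from pts(2,3) obtain m n x2' x3 x5 where QR': "Q = Affine x2' (m * x2' + n)" "R = Affine x3 (m * x3 + n)"
      "collinear m n x2' x3 x5" "ec_add f Q R = Affine x5 (- (m * x5 + n))"
      by (cases rule: ec_add_cases) (use 7 in auto)
    from PQ(2) QR'(1) have [simp]: "x2' = x2" and q: "l * x2 + k = m * x2 + n" by auto
    note QR = QR'[unfolded \<open>x2' = x2\<close>]
    from ec_add_closed[OF pts(1,2)] pts(3) obtain L K y4 y3 x6 where L: 
      "ec_add f P Q = Affine y4 (L * y4 + K)" "R = Affine y3 (L * y3 + K)"
      "collinear L K y4 y3 x6" "ec_add f (ec_add f P Q) R = Affine x6 (- (L * x6 + K))"
      by (cases rule: ec_add_cases) (use 7 PQ(4) ne(2) in auto)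
    from pts(1) ec_add_closed[OF pts(2,3)] obtain M N z1 z5 x7 where M:
      "P = Affine z1 (M * z1 + N)" "ec_add f Q R = Affine z5 (M * z5 + N)"
      "collinear M N z1 z5 x7" "ec_add f P (ec_add f Q R) = Affine x7 (- (M * x7 + N))"
      by (cases rule: ec_add_cases) (use 7 QR(4) ne(4) in auto)
    have "x3 \<noteq> x4"
    proof
      assume "x3 = x4"
      with ne(1,2) PQ(4) QR(2) show False
        using points_same_x[of x4 "- (l * x4 + k)" "m * x4 + n"] pts(3) ec_add_closed[OF pts(1,2)]
        by (metis ec_neg.simps(2) minus_minus)
    qed
    have "x1 \<noteq> x5"
    proof
      assume "x1 = x5"
      with ne(3,4) QR(4) PQ(1) show False
        using points_same_x[of x5 "- (m * x5 + n)" "l * x5 + k"] pts(1) ec_add_closed[OF pts(2,3)]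
        by (metis ec_neg.simps(2) minus_minus)
    qed
    have "x1 \<noteq> x3 \<or> l \<noteq> m"
      using 7 PQ(1) QR(2) q by auto
    have eqs: "y4 = x4" "y3 = x3" "z1 = x1" "z5 = x5"
      "L * x4 + K = - (l * x4 + k)" "L * x3 + K = m * x3 + n"
      "M * x1 + N = l * x1 + k" "M * x5 + N = - (m * x5 + n)"
      using L M PQ QR by auto
    note col = PQ(3)[unfolded collinear_def] QR(3)[unfolded collinear_def]
      L(3)[unfolded collinear_def eqs] M(3)[unfolded collinear_def eqs]
    have "(x3 - x4) * ((l - m) * (L + l) - (x1 - x3)) = 0"
      using q eqs(5,6) col(1,2) by Groebner_Basis.algebra
    then have Ll: "(l - m) * (L + l) = x1 - x3"
      using \<open>x3 \<noteq> x4\<close> by simp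
    have "(x1 - x5) * ((l - m) * (M + m) - (x1 - x3)) = 0"
      using q eqs(7,8) col(1,2) by Groebner_Basis.algebra
    then have Mm: "(l - m) * (M + m) = x1 - x3"
      using \<open>x1 \<noteq> x5\<close> by simp
    \<comment> \<open>For \<open>l = m\<close> all points lie on one line, and \<open>R\<close> would be \<open>P\<close>.\<close>
    have "l \<noteq> m"
      using \<open>x1 \<noteq> x3 \<or> l \<noteq> m\<close> Ll by auto
    then have t: "L + l = M + m"
      using Ll Mm by (metis mult_cancel_left right_minus_eq)
    have x6: "x6 = x7"
      using col Ll t by Groebner_Basis.algebra
    moreover have "L * x6 + K = M * x6 + N"
      using q eqs(5-8) col Ll Mm t x6 by Groebner_Basis.algebra
    ultimately show ?thesis
      using L(4) M(4) by simp
  qed (use pts in auto)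
qed


lemma ec_neg_ec_add_cancel_right:
  assumes "P \<in> points" "Q \<in> points"
  shows "ec_add f (ec_add f P Q) (ec_neg Q) = P"
  using assms ec_neg_add_cancel[of Q P] by (metis ec_add_commute ec_add_closed ec_neg_in_points)

lemma finite_avoid_points:
  assumes "finite B"
  obtains S where "S \<in> points" "S \<notin> B"
proof -
  have "finite ((\<lambda>P. case P of Infinity \<Rightarrow> 0 | Affine x y \<Rightarrow> x) ` B)" (is "finite ?X")
    using assms by simp
  then obtain x where "x \<notin> ?X"
    using ex_new_if_finite infinite_UNIV_char_0 by blast
  moreover obtain y where "y ^ 2 = poly f x"
    using nth_root_exists[of 2 "poly f x"] by auto
  ultimately show thesis
    by (intro that[of "Affine x y"]) force+
qed

text \<open>
  For arbitrary points, add a further point \<open>T\<close> to both sides. Outside a finite set of choices of \<open>T\<close>, the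
  generic case applies to each step of
  \<open>((P + Q) + R) + T = (P + Q) + (R + T) = P + (Q + (R + T)) = P + ((Q + R) + T) = (P + (Q + R)) + T\<close>,
  and \<open>T\<close> is then cancelled.
\<close>

lemma ec_add_assoc:
  assumes pts: "P \<in> points" "Q \<in> points" "R \<in> points"
  shows "ec_add f (ec_add f P Q) R = ec_add f P (ec_add f Q R)"
proof -
  \<comment> \<open>\<open>D V W\<close> holds the points \<open>T\<close> for which \<open>V + T\<close> and \<open>W\<close> have the same \<open>X\<close>-coordinate.\<close>
  define D where "D V W = {ec_add f (ec_neg V) W, ec_add f (ec_neg V) (ec_neg W)}" for V W
  have avoid: "ec_add f V T \<noteq> W" "ec_add f V T \<noteq> ec_neg W"
    if "T \<in> points" "V \<in> points" "T \<notin> D V W" for V W T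
    using that ec_neg_add_cancel[of V T] by (auto simp: D_def)
  let ?PQ = "ec_add f P Q" and ?QR = "ec_add f Q R"
  let ?A = "ec_add f ?PQ R" and ?B = "ec_add f P ?QR"
  have cl [simp]: "?PQ \<in> points" "?QR \<in> points" "?A \<in> points" "?B \<in> points"
    using pts ec_add_closed by auto
  have "finite ({?A, ec_neg ?A, ?QR, ec_neg ?QR, ?B, ec_neg ?B} \<union> D R ?PQ \<union> D R Q \<union> D ?QR P)"
    by (simp add: D_def)
  then obtain T where T: "T \<in> points"
    and T_bad: "T \<notin> {?A, ec_neg ?A, ?QR, ec_neg ?QR, ?B, ec_neg ?B} \<union> D R ?PQ \<union> D R Q \<union> D ?QR P"
    by (rule finite_avoid_points)
  have sums: "ec_add f V T \<in> points" if "V \<in> points" for V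
    using that T ec_add_closed by blast
  have T_ne: "W \<noteq> T" "W \<noteq> ec_neg T" if "W \<in> {?A, ?QR, ?B}" for W
  proof -
    have "W \<noteq> T" "ec_neg W \<noteq> T" using that T_bad by auto
    then show "W \<noteq> T" "W \<noteq> ec_neg T" by auto
  qed
  note RT = avoid[OF T pts(3)]
  have "ec_add f ?A T = ec_add f ?PQ (ec_add f R T)"
    using T T_bad T_ne[of ?A] RT[of ?PQ] pts by (intro ec_add_assoc_generic) auto
  also have QRT: "ec_add f ?QR T = ec_add f Q (ec_add f R T)"
    using T T_bad T_ne[of ?QR] RT[of Q] pts by (intro ec_add_assoc_generic) auto
  have "ec_add f ?PQ (ec_add f R T) = ec_add f P (ec_add f Q (ec_add f R T))"
    using T T_bad RT[of ?PQ] avoid[OF T cl(2), of P] pts sums[of R]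
    by (intro ec_add_assoc_generic) (auto simp flip: QRT)
  also have "\<dots> = ec_add f P (ec_add f ?QR T)"
    by (simp only: QRT)
  also have "\<dots> = ec_add f ?B T"
    using T T_bad T_ne[of ?B] avoid[OF T cl(2), of P] pts
    by (intro ec_add_assoc_generic[symmetric]) auto
  finally show ?thesis
    using T cl ec_neg_ec_add_cancel_right by metis
qed


lemma ec_add_closed_subfield:
  assumes K: "subfield K ring_of_type_algebra" and coeffs: "a \<in> K" "b \<in> K"
    and P: "P \<in> carrier (ec_group f K)" and Q: "Q \<in> carrier (ec_group f K)"
  shows "ec_add f P Q \<in> carrier (ec_group f K)"
proof -
  have "P \<in> points" "Q \<in> points"
    using P Q by (auto simp: ec_group_def)
  from ec_add_closed[OF this] have sum: "ec_add f P Q \<in> points" .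
  note closed = subfield_closed[OF K]
  show ?thesis
  proof (cases P; cases Q)
    fix x1 y1 x2 y2 assume PQ: "P = Affine x1 y1" "Q = Affine x2 y2"
    then have in_K: "x1 \<in> K" "y1 \<in> K" "x2 \<in> K" "y2 \<in> K"
      using P Q by (auto simp: ec_group_def)
    define l where "l = (if x1 = x2 then poly (pderiv f) x1 / (2 * y1) else (y2 - y1) / (x2 - x1))"
    define x3 where "x3 = l ^ 2 - a - x1 - x2"
    have "2 \<in> K" "3 \<in> K"
      using closed(2)[OF closed(1) closed(1)] closed(1)
        closed(2)[OF closed(2)[OF closed(1) closed(1)] closed(1)] by auto
    then have "poly (pderiv f) x1 \<in> K"
      unfolding poly_pderiv_f using closed coeffs in_K by (auto simp: power2_eq_square)
    then have "l \<in> K"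
      using closed in_K \<open>2 \<in> K\<close> by (auto simp: l_def)
    have "x3 \<in> K"
      unfolding x3_def power2_eq_square by (intro closed(3,4) \<open>l \<in> K\<close> in_K coeffs)
    have "l * (x1 - x3) - y1 \<in> K"
      by (intro closed(3,4) \<open>l \<in> K\<close> \<open>x3 \<in> K\<close> in_K)
    moreover have "ec_add f P Q = (if x1 = x2 \<and> y1 = - y2 then Infinity else Affine x3 (l * (x1 - x3) - y1))"
      unfolding PQ ec_add.simps(3) coeff_f_2 Let_def x3_def l_def ..
    ultimately show ?thesis
      using sum \<open>x3 \<in> K\<close> by (auto simp: ec_group_def)
  qed (use P Q in auto)
qed

lemma comm_group_ec_group:
  assumes "subfield K ring_of_type_algebra" "a \<in> K" "b \<in> K"
  shows "comm_group (ec_group f K)"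
proof (rule comm_groupI)
  have sub: "carrier (ec_group f K) \<subseteq> points"
    by (auto simp: ec_group_def)
  fix P Q R
  assume P: "P \<in> carrier (ec_group f K)"
  show "\<one>\<^bsub>ec_group f K\<^esub> \<otimes>\<^bsub>ec_group f K\<^esub> P = P"
    by (simp add: ec_group_def)
  have "ec_neg P \<in> carrier (ec_group f K)"
    using P subfield_closed(5)[OF assms(1)] by (cases P) (auto simp: ec_group_def)
  then show "\<exists>Q\<in>carrier (ec_group f K). Q \<otimes>\<^bsub>ec_group f K\<^esub> P = \<one>\<^bsub>ec_group f K\<^esub>"
    by (intro bexI[of _ "ec_neg P"]) (auto simp: ec_group_def)
  assume Q: "Q \<in> carrier (ec_group f K)"
  show "P \<otimes>\<^bsub>ec_group f K\<^esub> Q \<in> carrier (ec_group f K)"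
    using ec_add_closed_subfield[OF assms P Q] by (simp add: ec_group_def)
  show "P \<otimes>\<^bsub>ec_group f K\<^esub> Q = Q \<otimes>\<^bsub>ec_group f K\<^esub> P"
    using ec_add_commute[of P Q] sub P Q by (auto simp: ec_group_def)
  assume R: "R \<in> carrier (ec_group f K)"
  show "P \<otimes>\<^bsub>ec_group f K\<^esub> Q \<otimes>\<^bsub>ec_group f K\<^esub> R = P \<otimes>\<^bsub>ec_group f K\<^esub> (Q \<otimes>\<^bsub>ec_group f K\<^esub> R)"
    using ec_add_assoc[of P Q R] sub P Q R by (auto simp: ec_group_def)
qed (auto simp: ec_group_def)

end

section \<open>Valuation rings\<close>

locale unital_subring =
  fixes V :: "'a :: field set"
  assumes one_mem [simp, intro]: "1 \<in> V"
    and add_mem [intro]: "x \<in> V \<Longrightarrow> y \<in> V \<Longrightarrow> x + y \<in> V"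
    and uminus_mem: "x \<in> V \<Longrightarrow> - x \<in> V"
    and mult_mem [intro]: "x \<in> V \<Longrightarrow> y \<in> V \<Longrightarrow> x * y \<in> V"
begin

lemma zero_mem [simp, intro]: "0 \<in> V"
  using add_mem[OF one_mem uminus_mem[OF one_mem]] by simp

lemma uminus_mem_iff [simp]: "- x \<in> V \<longleftrightarrow> x \<in> V"
  using uminus_mem[of x] uminus_mem[of "- x"] by auto

lemma diff_mem [intro]: "x \<in> V \<Longrightarrow> y \<in> V \<Longrightarrow> x - y \<in> V"
  using add_mem[of x "- y"] by simp

lemma power_mem [intro]: "x \<in> V \<Longrightarrow> x ^ n \<in> V"
  by (induction n) auto

lemma of_nat_mem [simp, intro]: "of_nat n \<in> V"
  by (induction n) auto

lemma numeral_mem [simp, intro]: "numeral n \<in> V"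
  using of_nat_mem[of "numeral n"] by simp

lemma sum_mem: "(\<And>i. i \<in> I \<Longrightarrow> g i \<in> V) \<Longrightarrow> sum g I \<in> V"
  by (induction I rule: infinite_finite_induct) auto

definition adjoin_elem :: "'a \<Rightarrow> 'a set" where
  "adjoin_elem x = {poly q x | q. \<forall>i. Polynomial.coeff q i \<in> V}"

lemma unital_subring_adjoin_elem: "unital_subring (adjoin_elem x)"
proof
  show "1 \<in> adjoin_elem x"
    unfolding adjoin_elem_def by (rule CollectI, rule exI[of _ 1]) (auto simp: coeff_1)
next
  fix u v assume "u \<in> adjoin_elem x" "v \<in> adjoin_elem x"
  then obtain p q where pq: "u = poly p x" "v = poly q x"
    "\<And>i. Polynomial.coeff p i \<in> V" "\<And>i. Polynomial.coeff q i \<in> V"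
    by (auto simp: adjoin_elem_def)
  show "u + v \<in> adjoin_elem x"
    unfolding adjoin_elem_def by (rule CollectI, rule exI[of _ "p + q"]) (use pq in auto)
  show "u * v \<in> adjoin_elem x"
    unfolding adjoin_elem_def
    by (rule CollectI, rule exI[of _ "p * q"]) (use pq in \<open>auto simp: coeff_mult intro: sum_mem\<close>)
  show "- u \<in> adjoin_elem x"
    unfolding adjoin_elem_def by (rule CollectI, rule exI[of _ "- p"]) (use pq in auto)
qed

lemma adjoin_elem_superset: "V \<subseteq> adjoin_elem x"
proof
  fix v assume "v \<in> V"
  then show "v \<in> adjoin_elem x"
    unfolding adjoin_elem_def
    by (intro CollectI exI[of _ "[:v:]"]) (auto simp: coeff_pCons split: nat.splits)
qed

lemma adjoin_elem_contains: "x \<in> adjoin_elem x"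
  unfolding adjoin_elem_def
  by (rule CollectI, rule exI[of _ "[:0, 1:]"]) (auto simp: coeff_pCons split: nat.splits)

text \<open>
  The \<open>V\<close>-module spanned by the first \<open>n\<close> powers; the bound \<open>n\<close> is the quantity minimised in the
  existence proof below.
\<close>

definition span_powers :: "nat \<Rightarrow> 'a \<Rightarrow> 'a set" where
  "span_powers n x = {(\<Sum>i<n. h i * x ^ i) | h. \<forall>i. h i \<in> V}"

lemma adjoin_elem_span:
  assumes "y \<in> adjoin_elem x"
  obtains n where "y \<in> span_powers n x"
proof -
  from assms obtain q where "y = poly q x" "\<And>i. Polynomial.coeff q i \<in> V"
    by (auto simp: adjoin_elem_def)
  then have "y \<in> span_powers (Suc (degree q)) x"
    unfolding span_powers_def poly_altdef lessThan_Suc_atMost by blast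
  then show thesis by (rule that)
qed

lemma span_powers_add:
  assumes "u \<in> span_powers n x" "v \<in> span_powers n x"
  shows "u + v \<in> span_powers n x"
proof -
  from assms obtain g h where "u = (\<Sum>i<n. g i * x ^ i)" "v = (\<Sum>i<n. h i * x ^ i)"
    "\<forall>i. g i \<in> V" "\<forall>i. h i \<in> V"
    by (auto simp: span_powers_def)
  then show ?thesis
    unfolding span_powers_def
    by (intro CollectI exI[of _ "\<lambda>i. g i + h i"]) (auto simp: sum.distrib distrib_right)
qed

lemma span_powers_smult:
  assumes "u \<in> span_powers n x" "v \<in> V"
  shows "v * u \<in> span_powers n x"
proof -
  from assms obtain g where "u = (\<Sum>i<n. g i * x ^ i)" "\<forall>i. g i \<in> V"
    by (auto simp: span_powers_def)
  with assms show ?thesis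
    unfolding span_powers_def
    by (intro CollectI exI[of _ "\<lambda>i. v * g i"]) (auto simp: sum_distrib_left mult.assoc)
qed

lemma span_powers_power:
  assumes "i < n"
  shows "x ^ i \<in> span_powers n x"
  unfolding span_powers_def
  by (intro CollectI exI[of _ "\<lambda>j. if j = i then 1 else 0"])
    (use assms in \<open>auto simp: if_distrib[of "\<lambda>t. t * _"] sum.delta cong: if_cong\<close>)

lemma span_powers_sum:
  assumes "finite I" "\<And>i. i \<in> I \<Longrightarrow> g i \<in> span_powers n x"
  shows "sum g I \<in> span_powers n x"
  using assms
proof (induction I)
  case empty
  show ?case unfolding span_powers_def by (auto intro!: exI[of _ "\<lambda>_. 0"])
qed (auto intro: span_powers_add)

end

locale valuation_ring = unital_subring +
  assumes total: "x \<in> V \<or> inverse x \<in> V"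

text \<open>
  A special case of Chevalley's extension theorem. Among the subrings that contain \<open>A\<close> but not \<open>1/p\<close>
  choose a maximal one, \<open>V\<close>. Elements \<open>1 - p v\<close> are units of \<open>V\<close>, since inverting one of them does not make
  \<open>p\<close> invertible. If neither \<open>x\<close> nor \<open>1/x\<close> were in \<open>V\<close>, then \<open>1/p\<close> would be a polynomial over \<open>V\<close> both in
  \<open>x\<close> and in \<open>1/x\<close>. Take both of minimal length; by symmetry the one in \<open>x\<close> is the longer. The
  relation in \<open>1/x\<close>, divided by the unit \<open>1 - p h 0\<close>, expresses the top power of \<open>x\<close> by smaller powers
  and shortens the relation in \<open>x\<close>.
\<close>

lemma exists_valuation_ring:
  fixes p :: "'a :: field"
  assumes A: "unital_subring A" and p: "p \<in> A" "inverse p \<notin> A"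
  obtains V where "valuation_ring V" "A \<subseteq> V" "inverse p \<notin> V"
proof -
  define F where "F = {B. unital_subring B \<and> A \<subseteq> B \<and> inverse p \<notin> B}"
  have "\<exists>V\<in>F. \<forall>B\<in>F. V \<subseteq> B \<longrightarrow> B = V"
  proof (rule subset_Zorn_nonempty)
    show "F \<noteq> {}" using A p by (auto simp: F_def)
  next
    fix C assume C: "C \<noteq> {}" "subset.chain F C"
    then have sub: "B \<in> C \<Longrightarrow> unital_subring B \<and> A \<subseteq> B \<and> inverse p \<notin> B" for B
      by (auto simp: F_def subset.chain_def)
    have common: "\<exists>B\<in>C. x \<in> B \<and> y \<in> B" if "x \<in> \<Union>C" "y \<in> \<Union>C" for x y
    proof -
      from that obtain B B' where "B \<in> C" "x \<in> B" "B' \<in> C" "y \<in> B'" by blast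
      moreover from this have "B \<subseteq> B' \<or> B' \<subseteq> B"
        using C(2) unfolding subset_chain_def by blast
      ultimately show ?thesis by blast
    qed
    have "unital_subring (\<Union>C)"
    proof
      show "1 \<in> \<Union>C"
        using C(1) sub unital_subring.one_mem by blast
      show "- x \<in> \<Union>C" if "x \<in> \<Union>C" for x
        using that sub unital_subring.uminus_mem by blast
      fix x y assume "x \<in> \<Union>C" "y \<in> \<Union>C"
      then obtain B where "B \<in> C" "x \<in> B" "y \<in> B"
        using common by blast
      then show "x + y \<in> \<Union>C" "x * y \<in> \<Union>C"
        using sub unital_subring.add_mem unital_subring.mult_mem by blast+
    qed
    then show "\<Union>C \<in> F"
      using C(1) sub unfolding F_def by blast
  qed
  then obtain V where "V \<in> F" and max: "\<And>B. B \<in> F \<Longrightarrow> V \<subseteq> B \<Longrightarrow> B = V"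
    by blast
  then have V: "unital_subring V" "A \<subseteq> V" "inverse p \<notin> V"
    by (auto simp: F_def)
  then interpret unital_subring V by simp
  have "p \<in> V" "p \<noteq> 0" using p V by auto
  have inv_p: "inverse p \<in> adjoin_elem x" if "x \<notin> V" for x
  proof (rule ccontr)
    assume "inverse p \<notin> adjoin_elem x"
    then have "adjoin_elem x = V"
      using max[of "adjoin_elem x"] V(2) unital_subring_adjoin_elem[of x] adjoin_elem_superset[of x]
      by (auto simp: F_def)
    then show False using that adjoin_elem_contains by blast
  qed
  have unit: "inverse (1 - p * v) \<in> V" if v: "v \<in> V" for v
  proof (rule ccontr)
    let ?u = "1 - p * v"
    assume "inverse ?u \<notin> V"
    from inv_p[OF this] obtain n where "inverse p \<in> span_powers n (inverse ?u)"
      by (rule adjoin_elem_span)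
    then obtain h where h: "inverse p = (\<Sum>i<n. h i * inverse ?u ^ i)" "\<forall>i. h i \<in> V"
      by (auto simp: span_powers_def)
    have "?u \<noteq> 0"
    proof
      assume "?u = 0"
      then have "inverse p = v" by (intro inverse_unique) simp
      then show False using v V by simp
    qed
    have "?u ^ n * inverse p = (\<Sum>i<n. h i * ?u ^ (n - i))"
      unfolding h(1) sum_distrib_left
    proof (rule sum.cong)
      fix i assume "i \<in> {..<n}"
      then have "?u ^ n = ?u ^ i * ?u ^ (n - i)"
        by (simp flip: power_add)
      then show "?u ^ n * (h i * inverse ?u ^ i) = h i * ?u ^ (n - i)"
        using \<open>?u \<noteq> 0\<close> by (simp add: field_simps)
    qed simp
    also have "\<dots> \<in> V"
      using h(2) v \<open>p \<in> V\<close> by (intro sum_mem mult_mem power_mem diff_mem) auto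
    finally have un: "?u ^ n * inverse p \<in> V" .
    have "\<exists>w\<in>V. ?u ^ k = 1 - p * w" for k
    proof (induction k)
      case (Suc k)
      then obtain w where "w \<in> V" "?u ^ k = 1 - p * w" by blast
      then have "?u ^ Suc k = ?u * (1 - p * w)"
        by (simp only: power_Suc)
      also have "\<dots> = 1 - p * (v + w - p * v * w)"
        by (simp add: algebra_simps)
      finally show ?case using \<open>w \<in> V\<close> v \<open>p \<in> V\<close> by (intro bexI[of _ "v + w - p * v * w"]) auto
    qed (auto intro: bexI[of _ 0])
    then obtain w where w: "w \<in> V" "?u ^ n = 1 - p * w" by blast
    have "inverse p = ?u ^ n * inverse p + w"
      unfolding w(2) using \<open>p \<noteq> 0\<close> by (simp add: field_simps)
    then have "inverse p \<in> V" using un w(1) by (metis add_mem)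
    then show False using V by simp
  qed
  have False if "x \<notin> V" "inverse x \<notin> V"
    "inverse p \<in> span_powers (Suc m) (inverse x)"
    "inverse p \<in> span_powers (Suc n) x" "inverse p \<notin> span_powers n x" "m \<le> n"
    for x m n
  proof -
    have "x \<noteq> 0" using that by auto
    from that(3) obtain h where h: "inverse p = (\<Sum>i<Suc m. h i * inverse x ^ i)" "\<forall>i. h i \<in> V"
      by (auto simp: span_powers_def)
    define w where "w = inverse (1 - p * h 0)"
    have "w \<in> V" using unit h(2) by (simp add: w_def)
    have "1 - p * h 0 \<noteq> 0"
    proof
      assume "1 - p * h 0 = 0"
      then have "inverse p = h 0" by (intro inverse_unique) simp
      then show False using h(2) V by metis
    qed
    have "1 = p * (h 0 + (\<Sum>i<m. h (Suc i) * inverse x ^ Suc i))"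
      using h(1) \<open>p \<noteq> 0\<close> unfolding sum.lessThan_Suc_shift by (simp add: field_simps)
    then have tail: "1 - p * h 0 = p * (\<Sum>i<m. h (Suc i) * inverse x ^ Suc i)"
      by (simp add: algebra_simps)
    have "w * (1 - p * h 0) = 1"
      using \<open>1 - p * h 0 \<noteq> 0\<close> by (simp add: w_def)
    then have "1 = w * (p * (\<Sum>i<m. h (Suc i) * inverse x ^ Suc i))"
      unfolding tail by (rule sym)
    then have "x ^ n = w * (p * (\<Sum>i<m. h (Suc i) * inverse x ^ Suc i)) * x ^ n"
      by simp
    also have "\<dots> = w * (p * (\<Sum>i<m. h (Suc i) * (inverse x ^ Suc i * x ^ n)))"
      by (simp add: sum_distrib_right sum_distrib_left mult.assoc)
    also have "(\<Sum>i<m. h (Suc i) * (inverse x ^ Suc i * x ^ n)) = (\<Sum>i<m. h (Suc i) * x ^ (n - Suc i))"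
    proof (rule sum.cong)
      fix i assume "i \<in> {..<m}"
      then have "x ^ n = x ^ Suc i * x ^ (n - Suc i)"
        using that(6) by (simp flip: power_add del: power_Suc)
      moreover have "inverse x ^ Suc i * x ^ Suc i = 1"
        using \<open>x \<noteq> 0\<close> by (simp flip: power_mult_distrib del: power_Suc)
      ultimately show "h (Suc i) * (inverse x ^ Suc i * x ^ n) = h (Suc i) * x ^ (n - Suc i)"
        by (metis mult.assoc mult_1)
    qed simp
    also have "w * (p * \<dots>) \<in> span_powers n x"
      using \<open>w \<in> V\<close> \<open>p \<in> V\<close> h(2) that(6)
      by (intro span_powers_smult span_powers_sum span_powers_power) auto
    finally have xn: "x ^ n \<in> span_powers n x" .
    from that(4) obtain g where g: "inverse p = (\<Sum>i<Suc n. g i * x ^ i)" "\<forall>i. g i \<in> V"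
      by (auto simp: span_powers_def)
    have "(\<Sum>i<n. g i * x ^ i) \<in> span_powers n x"
      using g(2) by (auto simp: span_powers_def)
    then have "inverse p \<in> span_powers n x"
      unfolding g(1) using g(2) xn by (auto intro: span_powers_add span_powers_smult)
    then show False using that(5) by simp
  qed
  note contra = this
  have least: "\<exists>n. inverse p \<in> span_powers (Suc n) x \<and> inverse p \<notin> span_powers n x"
    if x: "x \<notin> V" for x
  proof -
    obtain k where k: "inverse p \<in> span_powers k x"
      using inv_p[OF x] by (rule adjoin_elem_span)
    have "inverse p \<notin> span_powers 0 x" using \<open>p \<noteq> 0\<close> by (auto simp: span_powers_def)
    from ex_least_nat_less[of "\<lambda>k. inverse p \<in> span_powers k x", OF k this]
    show ?thesis by blast
  qed
  have "valuation_ring V"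
  proof
    fix x
    show "x \<in> V \<or> inverse x \<in> V"
    proof (rule ccontr)
      assume "\<not> ?thesis"
      then have x: "x \<notin> V" "inverse x \<notin> V" by auto
      obtain n where n: "inverse p \<in> span_powers (Suc n) x" "inverse p \<notin> span_powers n x"
        using least[OF x(1)] by blast
      obtain m where m: "inverse p \<in> span_powers (Suc m) (inverse x)" "inverse p \<notin> span_powers m (inverse x)"
        using least[OF x(2)] by blast
      show False
      proof (cases "m \<le> n")
        case True
        then show False using contra[OF x m(1) n] by blast
      next
        case False
        then show False using contra[of "inverse x" n m] x m n by simp
      qed
    qed
  qed
  then show thesis using that V by blast
qed

context valuation_ring
begin

text \<open>
  Divisibility in \<open>V\<close> replaces a valuation \<open>v\<close> with values in an ordered group: \<open>x \<in> max_ideal\<close>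
  stands for \<open>v x > 0\<close> and \<open>x \<approx> y\<close> for \<open>v x = v y < \<infinity>\<close>.
\<close>

definition max_ideal :: "'a set" where
  "max_ideal = {x \<in> V. x = 0 \<or> inverse x \<notin> V}"

definition sim :: "'a \<Rightarrow> 'a \<Rightarrow> bool"  (infix \<open>\<approx>\<close> 50) where
  "x \<approx> y \<longleftrightarrow> x \<noteq> 0 \<and> y \<noteq> 0 \<and> x / y \<in> V \<and> y / x \<in> V"

lemma max_ideal_mem: "x \<in> max_ideal \<Longrightarrow> x \<in> V"
  by (simp add: max_ideal_def)

lemma one_not_max_ideal [simp]: "1 \<notin> max_ideal"
  by (simp add: max_ideal_def)

lemma zero_max_ideal [simp]: "0 \<in> max_ideal"
  by (simp add: max_ideal_def)

lemma not_mem_imp_inverse_max_ideal: "x \<notin> V \<Longrightarrow> inverse x \<in> max_ideal"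
  using total[of x] by (auto simp: max_ideal_def)

lemma max_ideal_mult:
  assumes "x \<in> max_ideal" "y \<in> V"
  shows "x * y \<in> max_ideal" "y * x \<in> max_ideal"
proof -
  have "inverse x \<in> V" if "inverse (x * y) \<in> V" "x \<noteq> 0" "y \<noteq> 0"
  proof -
    have "inverse x = inverse (x * y) * y" using that by (simp add: field_simps)
    then show ?thesis using that assms by (metis mult_mem)
  qed
  then show "x * y \<in> max_ideal" using assms by (auto simp: max_ideal_def)
  then show "y * x \<in> max_ideal" by (simp add: mult.commute)
qed

lemma max_ideal_uminus: "x \<in> max_ideal \<Longrightarrow> - x \<in> max_ideal"
  using max_ideal_mult(1)[of x "- 1"] by simp

lemma max_ideal_add:
  assumes "x \<in> max_ideal" "y \<in> max_ideal"
  shows "x + y \<in> max_ideal"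
proof (cases "x = 0 \<or> y = 0")
  case False
  have *: "u + v \<in> max_ideal" if "u / v \<in> V" "v \<in> max_ideal" "v \<noteq> 0" for u v
  proof -
    have "u + v = v * (u / v + 1)" using that by (simp add: field_simps)
    then show ?thesis using max_ideal_mult(1)[of v "u / v + 1"] that by auto
  qed
  from total[of "x / y"] show ?thesis
    using *[of x y] *[of y x] assms False by (auto simp: add.commute)
qed (use assms in auto)

lemma max_ideal_diff: "x \<in> max_ideal \<Longrightarrow> y \<in> max_ideal \<Longrightarrow> x - y \<in> max_ideal"
  using max_ideal_add[of x "- y"] max_ideal_uminus[of y] by simp

lemma max_ideal_power:
  assumes "x \<in> max_ideal" "n > 0"
  shows "x ^ n \<in> max_ideal"
  using assms max_ideal_mult(1)[of x "x ^ (n - 1)"] max_ideal_mem[of x]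
  by (auto simp flip: power_Suc)

lemma sim_refl: "x \<noteq> 0 \<Longrightarrow> x \<approx> x"
  by (simp add: sim_def)

lemma sim_sym: "x \<approx> y \<Longrightarrow> y \<approx> x"
  by (auto simp: sim_def)

lemma sim_trans [trans]: "x \<approx> y \<Longrightarrow> y \<approx> z \<Longrightarrow> x \<approx> z"
  using mult_mem[of "x / y" "y / z"] mult_mem[of "z / y" "y / x"] by (auto simp: sim_def)

lemma sim_mult: "x \<approx> y \<Longrightarrow> u \<approx> v \<Longrightarrow> x * u \<approx> y * v"
  using mult_mem[of "x / y" "u / v"] mult_mem[of "y / x" "v / u"] by (auto simp: sim_def)

lemma sim_divide: "x \<approx> y \<Longrightarrow> u \<approx> v \<Longrightarrow> x / u \<approx> y / v"
  using mult_mem[of "x / y" "v / u"] mult_mem[of "y / x" "u / v"] by (auto simp: sim_def mult.commute)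

lemma sim_power: "x \<approx> y \<Longrightarrow> x ^ n \<approx> y ^ n"
  by (induction n) (auto intro: sim_mult simp: sim_refl)

lemma sim_max_ideal: "x \<approx> y \<Longrightarrow> x \<in> max_ideal \<Longrightarrow> y \<in> max_ideal"
  using max_ideal_mult(1)[of x "y / x"] by (auto simp: sim_def)

lemma sim_mem: "x \<approx> y \<Longrightarrow> x \<in> V \<Longrightarrow> y \<in> V"
  using mult_mem[of x "y / x"] by (auto simp: sim_def)

lemma sim_trichotomy:
  assumes "x \<noteq> 0" "y \<noteq> 0"
  shows "x \<approx> y \<or> x / y \<in> max_ideal \<or> y / x \<in> max_ideal"
  using assms total[of "x / y"] by (auto simp: sim_def max_ideal_def)

lemma not_sim_max_ideal: "x / y \<in> max_ideal \<Longrightarrow> \<not> x \<approx> y"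
  by (auto simp: sim_def max_ideal_def)

lemma one_add_max_ideal: "x \<in> max_ideal \<Longrightarrow> 1 + x \<approx> 1"
proof -
  assume x: "x \<in> max_ideal"
  have "1 + x \<notin> max_ideal"
    using max_ideal_diff[of "1 + x" x] x by auto
  then show ?thesis
    using x by (auto simp: sim_def max_ideal_def field_class.field_divide_inverse)
qed

text \<open>
  A sum of two terms of different size has the size of its dominant term.
\<close>

lemma sim_add:
  assumes "x \<noteq> 0" "y / x \<in> max_ideal"
  shows "x + y \<approx> x"
proof -
  have "x * (1 + y / x) \<approx> x * 1"
    using assms by (intro sim_mult sim_refl one_add_max_ideal)
  moreover have "x * (1 + y / x) = x + y" using assms by (simp add: field_simps)
  ultimately show ?thesis by simp
qed

lemma power_max_ideal_imp:
  assumes "x ^ n \<in> max_ideal"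
  shows "x \<in> max_ideal"
proof (rule ccontr)
  assume x: "x \<notin> max_ideal"
  then have "x \<noteq> 0" "inverse x \<in> V"
    using total[of x] by (auto simp: max_ideal_def)
  then have "x ^ n * inverse x ^ n \<in> max_ideal"
    using assms by (intro max_ideal_mult power_mem)
  then show False using \<open>x \<noteq> 0\<close> by (simp flip: power_mult_distrib)
qed

lemma sim_powers_eq:
  assumes p: "p \<in> max_ideal" "p \<noteq> 0" and "p ^ i \<approx> p ^ j"
  shows "i = j"
proof -
  have "\<not> p ^ i \<approx> p ^ j" if "i < j" for i j
  proof
    assume "p ^ i \<approx> p ^ j"
    moreover have "p ^ j / p ^ i = p ^ (j - i)"
      using that p by (simp add: power_diff)
    moreover have "p ^ (j - i) \<in> max_ideal"
      using that p by (intro max_ideal_power) auto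
    ultimately show False
      using not_sim_max_ideal[of "p ^ j" "p ^ i"] sim_sym by simp
  qed
  then show ?thesis
    using assms(3) sim_sym by (meson linorder_cases)
qed

end

section \<open>The filtration of the points by depth\<close>

locale cubic_over_valuation_ring =
  monic_separable_cubic a b c f + valuation_ring V
  for a b c :: "'a :: {alg_closed_field, field_char_0}" and f :: "'a poly" and V :: "'a set" +
  assumes coeffs_mem: "a \<in> V" "b \<in> V" "c \<in> V" and two_max_ideal: "2 \<in> max_ideal"
begin

text \<open>
  Close to infinity the curve has the local parameter \<open>t = X/Y\<close>, and \<open>1/X\<close> has the size of \<open>t\<^sup>2\<close>. So the
  depth \<open>w\<close> of a point, defined up to units, measures how far the point lies in the filtration of the
  formal group.
\<close>

definition has_depth :: "'a ec_point \<Rightarrow> 'a \<Rightarrow> bool" where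
  "has_depth P w \<longleftrightarrow> (\<exists>x y. P = Affine x y \<and> inverse x \<approx> w)"

lemma has_depth_neg: "has_depth P w \<Longrightarrow> has_depth (ec_neg P) w"
  by (auto simp: has_depth_def)

lemma four_max_ideal: "4 \<in> max_ideal"
  using max_ideal_mult(1)[OF two_max_ideal, of 2] by simp

lemma sim_inverse: "x \<approx> y \<Longrightarrow> inverse x \<approx> inverse y"
  using sim_divide[of 1 1 x y] by (simp add: sim_refl field_class.field_divide_inverse)

lemma double_x_coordinate:
  assumes P: "Affine x y \<in> points" and y: "y \<noteq> 0"
  obtains x' y' where "ec_add f (Affine x y) (Affine x y) = Affine x' y'"
    "4 * poly f x * x' = poly (pderiv f) x ^ 2 - 4 * poly f x * (a + 2 * x)"
proof -
  define l where "l = poly (pderiv f) x / (2 * y)"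
  have "y \<noteq> - y" using y by simp
  then have "ec_add f (Affine x y) (Affine x y) = Affine (l ^ 2 - a - x - x) (l * (x - (l ^ 2 - a - x - x)) - y)"
    by (simp add: ec_add.simps(3) Let_def coeff_f_2 l_def)
  moreover have l: "2 * y * l = poly (pderiv f) x"
    using y by (simp add: l_def)
  have "4 * y ^ 2 * (l ^ 2 - a - x - x) = (2 * y * l) ^ 2 - 4 * y ^ 2 * (a + 2 * x)"
    by (simp add: algebra_simps power2_eq_square)
  then have "4 * y ^ 2 * (l ^ 2 - a - x - x) = poly (pderiv f) x ^ 2 - 4 * y ^ 2 * (a + 2 * x)"
    unfolding l .
  then have "4 * poly f x * (l ^ 2 - a - x - x) = poly (pderiv f) x ^ 2 - 4 * poly f x * (a + 2 * x)"
    using P by simp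
  ultimately show thesis by (rule that)
qed

lemma poly_f_sim_cube:
  assumes "inverse x \<in> max_ideal" "x \<noteq> 0"
  shows "poly f x \<approx> x ^ 3"
proof -
  let ?w = "inverse x"
  have "(a * x ^ 2 + b * x + c) / x ^ 3 = ?w * (a + b * ?w + c * ?w ^ 2)"
    using assms(2) by (simp add: field_simps power2_eq_square power3_eq_cube)
  moreover have "\<dots> \<in> max_ideal"
    using assms coeffs_mem max_ideal_mem by (intro max_ideal_mult add_mem mult_mem power_mem) auto
  ultimately show ?thesis
    using sim_add[of "x ^ 3" "a * x ^ 2 + b * x + c"] assms(2)
    by (simp add: poly_f add.assoc)
qed

lemma has_depth_sim: "has_depth P w \<Longrightarrow> w \<approx> u \<Longrightarrow> has_depth P u"
  unfolding has_depth_def using sim_trans by blast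

lemma has_depth_unique: "has_depth P w \<Longrightarrow> has_depth P u \<Longrightarrow> w \<approx> u"
  unfolding has_depth_def using sim_trans sim_sym by blast

lemma has_depth_double_affine:
  assumes P: "Affine x y \<in> points"
    and u: "poly f x \<approx> u"
    and v: "poly (pderiv f) x ^ 2 - 4 * poly f x * (a + 2 * x) \<approx> v"
  shows "has_depth (ec_add f (Affine x y) (Affine x y)) (4 * u / v)"
proof -
  have f: "poly f x \<noteq> 0" using u by (simp add: sim_def)
  then have "y \<noteq> 0" using P by auto
  with P obtain x' y' where dbl: "ec_add f (Affine x y) (Affine x y) = Affine x' y'"
    "4 * poly f x * x' = poly (pderiv f) x ^ 2 - 4 * poly f x * (a + 2 * x)"
    by (rule double_x_coordinate)
  from v have v': "4 * poly f x * x' \<approx> v" unfolding dbl(2) .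
  have "4 * poly f x / (4 * poly f x * x') \<approx> 4 * u / v"
    by (intro sim_divide[OF sim_mult[OF sim_refl u] v']) simp
  moreover have "4 * poly f x / (4 * poly f x * x') = inverse x'"
    using f by (simp add: field_simps)
  ultimately show ?thesis
    using dbl(1) by (auto simp: has_depth_def)
qed

text \<open>
  In the duplication formula, numerator and denominator are dominated by \<open>x\<^sup>4\<close> and \<open>4 x\<^sup>3\<close>.
\<close>

lemma has_depth_double:
  assumes P: "P \<in> points" "has_depth P w" and w: "w \<in> max_ideal"
  shows "has_depth (ec_add f P P) (4 * w)"
proof -
  from P(2) obtain x y where xy: "P = Affine x y" "inverse x \<approx> w"
    by (auto simp: has_depth_def)
  let ?w = "inverse x"
  have x: "x \<noteq> 0" "?w \<in> max_ideal"
    using sim_max_ideal[OF sim_sym[OF xy(2)] w] xy(2) by (auto simp: sim_def)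
  have f: "poly f x \<approx> x ^ 3"
    using poly_f_sim_cube x by blast
  then have "y \<noteq> 0" using xy P(1) by (auto simp: sim_def)
  define r where "r = - 2 * b * x ^ 2 - 8 * c * x + (b ^ 2 - 4 * a * c)"
  have num: "poly (pderiv f) x ^ 2 - 4 * poly f x * (a + 2 * x) = x ^ 4 + r"
    unfolding poly_f poly_pderiv_f r_def by Groebner_Basis.algebra
  have "r / x ^ 4 = ?w * (- 2 * b * ?w - 8 * c * ?w ^ 2 + (b ^ 2 - 4 * a * c) * ?w ^ 3)"
    using x(1) by (simp add: r_def field_simps power2_eq_square power3_eq_cube eval_nat_numeral)
  moreover have "\<dots> \<in> max_ideal"
    using x coeffs_mem max_ideal_mem
    by (intro max_ideal_mult add_mem mult_mem power_mem diff_mem) auto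
  ultimately have "x ^ 4 + r \<approx> x ^ 4"
    using x(1) by (intro sim_add) auto
  then have "has_depth (ec_add f P P) (4 * x ^ 3 / x ^ 4)"
    using has_depth_double_affine[of x y, folded xy(1)] P(1) f num by simp
  moreover have "4 * x ^ 3 / x ^ 4 \<approx> 4 * w"
  proof -
    have "4 * x ^ 3 / x ^ 4 = 4 * inverse x"
      using x(1) by (simp add: field_simps eval_nat_numeral)
    also have "\<dots> \<approx> 4 * w"
      using xy(2) by (intro sim_mult sim_refl) auto
    finally show ?thesis .
  qed
  ultimately show ?thesis by (rule has_depth_sim)
qed

text \<open>
  The shallower point dominates. Clearing denominators in the addition formula gives
  \<open>x3 (x2 - x1)\<^sup>2 = x1\<^sup>2 x2 (1 + r)\<close>, and every term of \<open>r\<close> is small when \<open>x1\<close> dominates \<open>x2\<close>, which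
  dominates \<open>1\<close>. For the term \<open>s\<close>, which contains the \<open>Y\<close>-coordinates, this is seen from its square.
\<close>

lemma has_depth_add:
  assumes P: "P \<in> points" "has_depth P w" and Q: "Q \<in> points" "has_depth Q u"
    and u: "u \<in> max_ideal" and w: "w / u \<in> max_ideal"
  shows "has_depth (ec_add f P Q) u"
proof -
  from P(2) obtain x1 y1 where P': "P = Affine x1 y1" "inverse x1 \<approx> w"
    by (auto simp: has_depth_def)
  from Q(2) obtain x2 y2 where Q': "Q = Affine x2 y2" "inverse x2 \<approx> u"
    by (auto simp: has_depth_def)
  have x2: "x2 \<noteq> 0" "inverse x2 \<in> max_ideal"
    using sim_max_ideal[OF sim_sym[OF Q'(2)] u] Q'(2) by (auto simp: sim_def)
  have "x1 \<noteq> 0" using P'(2) by (auto simp: sim_def)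
  have "w / u \<approx> inverse x1 / inverse x2"
    by (rule sim_sym[OF sim_divide[OF P'(2) Q'(2)]])
  then have t: "x2 / x1 \<in> max_ideal"
    using sim_max_ideal[OF _ w] by (simp add: field_class.field_divide_inverse mult.commute)
  define t where "t = x2 / x1"
  have x2_eq: "x2 = t * x1" using \<open>x1 \<noteq> 0\<close> by (simp add: t_def)
  have t': "t \<in> max_ideal" using t by (simp add: t_def)
  then have "t \<noteq> 1" by auto
  have x1: "inverse x1 \<in> max_ideal"
  proof -
    have "t * inverse x2 = inverse x1" using x2 by (simp add: t_def field_simps)
    then show ?thesis using max_ideal_mult(1)[OF t' max_ideal_mem[OF x2(2)]] by simp
  qed
  have ne: "x1 \<noteq> x2" using \<open>t \<noteq> 1\<close> x2_eq \<open>x1 \<noteq> 0\<close> by auto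
  define x3 where "x3 = ((y2 - y1) / (x2 - x1)) ^ 2 - a - x1 - x2"
  have sum: "\<exists>y3. ec_add f P Q = Affine x3 y3"
    using ne by (simp add: P'(1) Q'(1) ec_add.simps(3) Let_def coeff_f_2 x3_def)
  have curve: "y1 ^ 2 = poly f x1" "y2 ^ 2 = poly f x2"
    using P(1) Q(1) P'(1) Q'(1) by auto
  define s where "s = y1 * y2 / (x1 ^ 2 * x2)"
  have "s ^ 2 = poly f x1 * poly f x2 / (x1 ^ 4 * x2 ^ 2)"
    unfolding s_def power_divide power_mult_distrib curve by (simp flip: power_mult)
  also have "\<dots> \<approx> x1 ^ 3 * x2 ^ 3 / (x1 ^ 4 * x2 ^ 2)"
    using poly_f_sim_cube x1 x2 \<open>x1 \<noteq> 0\<close> by (intro sim_divide sim_mult sim_refl) auto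
  also have "x1 ^ 3 * x2 ^ 3 / (x1 ^ 4 * x2 ^ 2) = t"
    using x2 \<open>x1 \<noteq> 0\<close> by (simp add: t_def eval_nat_numeral)
  finally have "s ^ 2 \<in> max_ideal"
    using t' sim_max_ideal sim_sym by blast
  then have s: "s \<in> max_ideal" by (rule power_max_ideal_imp)
  define r where "r = t + inverse x1 * (2 * a + b * (inverse x2 + inverse x1)
    + 2 * c * (inverse x1 * inverse x2)) - s * 2"
  have "x3 * (x2 - x1) ^ 2 = (y2 - y1) ^ 2 - (a + x1 + x2) * (x2 - x1) ^ 2"
    using ne by (simp add: x3_def power_divide left_diff_distrib algebra_simps)
  also have "\<dots> = x1 * x2 * (x1 + x2) + 2 * a * x1 * x2 + b * (x1 + x2) + 2 * c - 2 * (y1 * y2)"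
    using curve unfolding poly_f by Groebner_Basis.algebra
  also have "\<dots> = x1 ^ 2 * x2 * (1 + r)"
    using x2 \<open>x1 \<noteq> 0\<close> unfolding r_def s_def t_def
    by (simp add: field_simps power2_eq_square)
  finally have x3_eq: "x3 * (x2 - x1) ^ 2 = x1 ^ 2 * x2 * (1 + r)" .
  have "r \<in> max_ideal"
    unfolding r_def
    using x1 x2 max_ideal_mem coeffs_mem s t'
    by (intro max_ideal_add max_ideal_diff max_ideal_mult(1) add_mem mult_mem) auto
  then have "x3 * (x2 - x1) ^ 2 / (x2 - x1) ^ 2 \<approx> x1 ^ 2 * x2 * 1 / (- x1) ^ 2"
    unfolding x3_eq
  proof (intro sim_divide sim_mult sim_refl one_add_max_ideal sim_power)
    have "- x1 + x2 \<approx> - x1"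
      using t' max_ideal_uminus \<open>x1 \<noteq> 0\<close> by (intro sim_add) (auto simp: t_def)
    then show "x2 - x1 \<approx> - x1" by simp
  qed (use x2 \<open>x1 \<noteq> 0\<close> in auto)
  then have "x3 \<approx> x2"
    using ne \<open>x1 \<noteq> 0\<close> by simp
  from sim_trans[OF sim_inverse[OF this] Q'(2)] show ?thesis
    using sum by (auto simp: has_depth_def)
qed

lemma has_depth_add':
  assumes "P \<in> points" "has_depth P w" "Q \<in> points" "has_depth Q u"
    and "u \<in> max_ideal" "w \<in> max_ideal" and "\<not> w \<approx> u"
  shows "has_depth (ec_add f P Q) u \<or> has_depth (ec_add f P Q) w"
proof -
  have "w \<noteq> 0" "u \<noteq> 0" using assms by (auto simp: has_depth_def sim_def)
  from sim_trichotomy[OF this] assms(7) consider "w / u \<in> max_ideal" | "u / w \<in> max_ideal"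
    by blast
  then show ?thesis
  proof cases
    case 1
    then show ?thesis using has_depth_add[of P w Q u] assms by blast
  next
    case 2
    then have "has_depth (ec_add f Q P) w"
      using has_depth_add[of Q u P w] assms by blast
    then show ?thesis
      using ec_add_commute[of P Q] assms by simp
  qed
qed

end

text \<open>
  The sizes are measured in the whole field, the group consists of the points over the subfield \<open>K\<close>.
\<close>

locale curve_group = cubic_over_valuation_ring a b c f V
  for a b c :: "'a :: {alg_closed_field, field_char_0}" and f :: "'a poly" and V :: "'a set" +
  fixes K :: "'a set"
  assumes K: "subfield K ring_of_type_algebra" and coeffs_K: "a \<in> K" "b \<in> K"
begin

sublocale E: comm_group "ec_group f K"
  using comm_group_ec_group[OF K coeffs_K] .

lemma carrier_points: "P \<in> carrier (ec_group f K) \<Longrightarrow> P \<in> points"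
  by (auto simp: ec_group_def)

lemma mult_eq: "P \<otimes>\<^bsub>ec_group f K\<^esub> Q = ec_add f P Q"
  by (simp add: ec_group_def)

lemma one_eq: "\<one>\<^bsub>ec_group f K\<^esub> = Infinity"
  by (simp add: ec_group_def)

lemma inv_eq:
  assumes P: "P \<in> carrier (ec_group f K)"
  shows "inv\<^bsub>ec_group f K\<^esub> P = ec_neg P"
proof (rule E.inv_equality[OF _ P])
  show "ec_neg P \<in> carrier (ec_group f K)"
    using P subfield_closed(5)[OF K] by (cases P) (auto simp: ec_group_def)
qed (simp add: ec_group_def)

text \<open>
  Doubling multiplies the depth by \<open>4\<close>, and adding the shallower point \<open>P\<close> to an even multiple restores its
  depth. So the exponent \<open>e\<close> is the number of factors \<open>2\<close> of \<open>n\<close>.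
\<close>

lemma has_depth_nat_pow:
  assumes P: "P \<in> carrier (ec_group f K)" "has_depth P w" and w: "w \<in> max_ideal"
    and "n > 0"
  shows "\<exists>e. has_depth (P [^]\<^bsub>ec_group f K\<^esub> (n :: nat)) (4 ^ e * w)"
  using \<open>n > 0\<close>
proof (induction n rule: less_induct)
  case (less n)
  have fours: "4 ^ e * w \<in> max_ideal" for e
    using max_ideal_mult(2)[OF w power_mem[OF numeral_mem]] .
  have dbl: "\<exists>e. has_depth (P [^]\<^bsub>ec_group f K\<^esub> (2 * j)) (4 * (4 ^ e * w))"
    if j: "j > 0" "j < n" for j :: nat
  proof -
    let ?Q = "P [^]\<^bsub>ec_group f K\<^esub> j"
    obtain e where e: "has_depth ?Q (4 ^ e * w)"
      using less.IH[OF j(2,1)] by blast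
    have "P [^]\<^bsub>ec_group f K\<^esub> (2 * j) = ec_add f ?Q ?Q"
      using E.nat_pow_mult[OF P(1), of j j] by (simp add: mult_eq mult_2)
    moreover have "has_depth (ec_add f ?Q ?Q) (4 * (4 ^ e * w))"
      by (rule has_depth_double[OF carrier_points[OF E.nat_pow_closed[OF P(1)]] e fours])
    ultimately show ?thesis by auto
  qed
  show ?case
  proof (cases "even n")
    case True
    then obtain j where "n = 2 * j" by (rule evenE)
    with dbl[of j] less.prems obtain e where "has_depth (P [^]\<^bsub>ec_group f K\<^esub> n) (4 * (4 ^ e * w))"
      by auto
    then show ?thesis by (intro exI[of _ "Suc e"]) (simp add: mult.assoc)
  next
    case False
    then obtain j where n: "n = 2 * j + 1" by (rule oddE)
    show ?thesis
    proof (cases "j = 0")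
      case True
      then show ?thesis using P n by (intro exI[of _ 0]) simp
    next
      case False
      with dbl[of j] n obtain e where e: "has_depth (P [^]\<^bsub>ec_group f K\<^esub> (2 * j)) (4 * (4 ^ e * w))"
        by auto
      have "w \<noteq> 0" using P(2) by (auto simp: has_depth_def sim_def)
      then have "4 * (4 ^ e * w) / w \<in> max_ideal"
        using max_ideal_mult(1)[OF four_max_ideal, of "4 ^ e"] by auto
      then have "has_depth (ec_add f (P [^]\<^bsub>ec_group f K\<^esub> (2 * j)) P) w"
        using has_depth_add[OF carrier_points[OF E.nat_pow_closed[OF P(1)]] e carrier_points[OF P(1)] P(2) w]
        by blast
      then show ?thesis
        by (intro exI[of _ 0]) (simp add: n mult_eq)
    qed
  qed
qed

lemma has_depth_int_pow:
  assumes P: "P \<in> carrier (ec_group f K)" "has_depth P w" and w: "w \<in> max_ideal"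
    and "n \<noteq> 0"
  shows "\<exists>e. has_depth (P [^]\<^bsub>ec_group f K\<^esub> (n :: int)) (4 ^ e * w)"
proof -
  let ?Q = "P [^]\<^bsub>ec_group f K\<^esub> nat \<bar>n\<bar>"
  have "nat \<bar>n\<bar> > 0" using \<open>n \<noteq> 0\<close> by simp
  from has_depth_nat_pow[OF P w this] obtain e where e: "has_depth ?Q (4 ^ e * w)" ..
  have "P [^]\<^bsub>ec_group f K\<^esub> n = (if n < 0 then ec_neg ?Q else ?Q)"
    unfolding int_pow_def2 by (subst inv_eq) (use P(1) in \<open>simp_all add: abs_if E.nat_pow_closed\<close>)
  with e show ?thesis
    using has_depth_neg[OF e] by (intro exI[of _ e]) (simp only: split: if_split, blast)
qed

lemma has_depth_finprod:
  assumes "finite T" "T \<noteq> {}"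
    and "\<And>t. t \<in> T \<Longrightarrow> g t \<in> carrier (ec_group f K)"
    and "\<And>t. t \<in> T \<Longrightarrow> has_depth (g t) (w t) \<and> w t \<in> max_ideal"
    and "\<And>s t. s \<in> T \<Longrightarrow> t \<in> T \<Longrightarrow> s \<noteq> t \<Longrightarrow> \<not> w s \<approx> w t"
  shows "\<exists>t\<in>T. has_depth (finprod (ec_group f K) g T) (w t)"
  using assms
proof (induction T rule: finite_ne_induct)
  case (singleton t)
  then show ?case by simp
next
  case (insert t T)
  then obtain s where s: "s \<in> T" "has_depth (finprod (ec_group f K) g T) (w s)"
    by auto
  have "finprod (ec_group f K) g (insert t T) = ec_add f (g t) (finprod (ec_group f K) g T)"
    using insert by (simp add: mult_eq)
  moreover have "has_depth (ec_add f (g t) (finprod (ec_group f K) g T)) (w s) \<or>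
      has_depth (ec_add f (g t) (finprod (ec_group f K) g T)) (w t)"
  proof (rule has_depth_add')
    show "finprod (ec_group f K) g T \<in> points"
      using insert by (intro carrier_points E.finprod_closed) auto
    have "s \<noteq> t" using s insert by auto
    then show "\<not> w t \<approx> w s" using insert s by auto
  qed (use insert s carrier_points in auto)
  ultimately show ?case using s by auto
qed

text \<open>
  Depths of nonzero multiples of different points never agree, so a nontrivial combination has the depth of one
  of its terms. The neutral element has no depth.
\<close>

lemma int_independentI:
  assumes S: "finite S" "S \<subseteq> carrier (ec_group f K)"
    and depth: "\<And>P. P \<in> S \<Longrightarrow> has_depth P (w P) \<and> w P \<in> max_ideal"
    and sep: "\<And>P Q e e'. P \<in> S \<Longrightarrow> Q \<in> S \<Longrightarrow> 4 ^ e * w P \<approx> 4 ^ e' * w Q \<Longrightarrow> P = Q"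
  shows "int_independent (ec_group f K) S"
  unfolding int_independent_def
proof (intro allI impI, rule ccontr)
  let ?G = "ec_group f K"
  fix n :: "'a ec_point \<Rightarrow> int"
  assume rel: "(\<Otimes>\<^bsub>?G\<^esub>P\<in>S. P [^]\<^bsub>?G\<^esub> n P) = \<one>\<^bsub>?G\<^esub>" and "\<not> (\<forall>P\<in>S. n P = 0)"
  define T where "T = {P \<in> S. n P \<noteq> 0}"
  have T: "finite T" "T \<noteq> {}" "T \<subseteq> S"
    using S \<open>\<not> (\<forall>P\<in>S. n P = 0)\<close> by (auto simp: T_def)
  have closed: "P [^]\<^bsub>?G\<^esub> n P \<in> carrier ?G" if "P \<in> S" for P
    using that S(2) by auto
  have "\<exists>e. has_depth (P [^]\<^bsub>?G\<^esub> n P) (4 ^ e * w P)" if "P \<in> T" for P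
    using that S(2) depth[of P] by (intro has_depth_int_pow) (auto simp: T_def)
  then obtain e where e: "\<And>P. P \<in> T \<Longrightarrow> has_depth (P [^]\<^bsub>?G\<^esub> n P) (4 ^ e P * w P)"
    by metis
  have "\<exists>P\<in>T. has_depth (\<Otimes>\<^bsub>?G\<^esub>P\<in>T. P [^]\<^bsub>?G\<^esub> n P) (4 ^ e P * w P)"
  proof (rule has_depth_finprod)
    fix P assume "P \<in> T"
    then show "has_depth (P [^]\<^bsub>?G\<^esub> n P) (4 ^ e P * w P) \<and> 4 ^ e P * w P \<in> max_ideal"
      using e depth T(3) max_ideal_mult(2)[OF _ power_mem[OF numeral_mem]] by blast
    show "P [^]\<^bsub>?G\<^esub> n P \<in> carrier ?G" using \<open>P \<in> T\<close> T(3) closed by auto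
    fix Q assume "Q \<in> T" "P \<noteq> Q"
    then show "\<not> 4 ^ e P * w P \<approx> 4 ^ e Q * w Q"
      using sep[of P Q "e P" "e Q"] \<open>P \<in> T\<close> T(3) by auto
  qed (use T in auto)
  moreover have "(\<Otimes>\<^bsub>?G\<^esub>P\<in>S. P [^]\<^bsub>?G\<^esub> n P) = (\<Otimes>\<^bsub>?G\<^esub>P\<in>T. P [^]\<^bsub>?G\<^esub> n P)"
    using S closed by (intro E.finprod_mono_neutral_cong) (auto simp: T_def)
  ultimately obtain P where "has_depth \<one>\<^bsub>?G\<^esub> (4 ^ e P * w P)"
    using rel by metis
  then show False
    by (simp add: one_eq has_depth_def)
qed

lemma abelian_rank_ge:
  assumes I: "finite I" "\<And>i. i \<in> I \<Longrightarrow> Q i \<in> carrier (ec_group f K)"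
    and depth: "\<And>i. i \<in> I \<Longrightarrow> has_depth (Q i) (w i) \<and> w i \<in> max_ideal"
    and sep: "\<And>i j e e'. i \<in> I \<Longrightarrow> j \<in> I \<Longrightarrow> 4 ^ e * w i \<approx> 4 ^ e' * w j \<Longrightarrow> i = j"
  shows "enat (card I) \<le> abelian_rank (ec_group f K)"
proof -
  have inj: "inj_on Q I"
  proof (rule inj_onI)
    fix i j assume ij: "i \<in> I" "j \<in> I" "Q i = Q j"
    then have "w i \<approx> w j"
      using depth[of i] depth[of j] has_depth_unique[of "Q j"] by simp
    then show "i = j" using sep[of i j 0 0] ij by simp
  qed
  define index where "index = inv_into I Q"
  have index: "index P \<in> I" "Q (index P) = P" if "P \<in> Q ` I" for P
    using that by (auto simp: index_def inv_into_into f_inv_into_f)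
  have "int_independent (ec_group f K) (Q ` I)"
  proof (rule int_independentI)
    show "finite (Q ` I)" "Q ` I \<subseteq> carrier (ec_group f K)" using I by auto
    fix P assume P: "P \<in> Q ` I"
    show "has_depth P (w (index P)) \<and> w (index P) \<in> max_ideal"
      using depth[OF index(1)[OF P]] index(2)[OF P] by simp
    fix P' e e' assume "P' \<in> Q ` I" "4 ^ e * w (index P) \<approx> 4 ^ e' * w (index P')"
    then show "P = P'" using sep index P by metis
  qed
  moreover have "Q ` I \<subseteq> carrier (ec_group f K)" using I by auto
  ultimately have "enat (card (Q ` I)) \<le> abelian_rank (ec_group f K)"
    unfolding abelian_rank_def using I(1) by (intro Sup_upper) blast
  then show ?thesis using inj by (simp add: card_image)
qed

end

section \<open>Points above iterated preimages of 0\<close>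

lemma splitK_subfield: "subfield (splitK m) ring_of_type_algebra"
  unfolding splitK_def by (rule adjoin_subfield)

lemmas splitK_closed = subfield_closed[OF splitK_subfield]

lemma i_in_splitK: "\<i> \<in> splitK m"
  using adjoin_subfield(2)[of \<rat> "{\<i>}"] adjoin_subfield(2)[of Qi "iterate_roots m"]
  by (auto simp: splitK_def Qi_def)

lemma f2i_csqrt [simp]: "f2i (csqrt (z - \<i>)) = z"
  by (simp add: f2i_def)

lemma csqrt_in_iterate_roots:
  "z \<in> iterate_roots n \<Longrightarrow> csqrt (z - \<i>) \<in> iterate_roots (Suc n)"
  by (simp add: iterate_roots_def funpow_swap1 del: funpow.simps(2) add: funpow_Suc_right)

lemma uminus_in_iterate_roots:
  assumes "z \<in> iterate_roots n" "n > 0"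
  shows "- z \<in> iterate_roots n"
proof -
  obtain k where "n = Suc k" using assms(2) gr0_implies_Suc by blast
  with assms(1) show ?thesis
    by (simp add: iterate_roots_def funpow_Suc_right f2i_def del: funpow.simps(2))
qed

lemma iterate_roots_subset_splitK:
  assumes "n \<le> m" "z \<in> iterate_roots n"
  shows "z \<in> splitK m"
  using assms
proof (induction n arbitrary: z rule: inc_induct)
  case base
  then show ?case using adjoin_subfield(2) by (auto simp: splitK_def)
next
  case (step n)
  have "csqrt (z - \<i>) \<in> splitK m"
    using step csqrt_in_iterate_roots by blast
  then have "csqrt (z - \<i>) * csqrt (z - \<i>) + \<i> \<in> splitK m"
    using splitK_closed(2,3) i_in_splitK by blast
  then show ?case by (simp flip: power2_eq_square)
qed

lemma poly_cubic_E: "poly cubic_E z = (z - \<i>) * (z + \<i>) * (z + 1 - \<i>)"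
  by (simp add: cubic_E_coeffs algebra_simps)

text \<open>
  Let \<open>w\<^sup>2 = z - i\<close>. The three factors of the cubic at \<open>z\<close> are \<open>z - i = w\<^sup>2\<close>, \<open>z + i\<close> and
  \<open>z + 1 - i = w\<^sup>2 + 1 = (w - i) (w + i)\<close>. Iterated preimages of \<open>0\<close> are closed under negation and
  \<open>x \<mapsto> sqrt (x - i)\<close> raises the level by one, which makes \<open>z - i\<close> and \<open>- z - i\<close> squares at level \<open>n + 1\<close>
  and \<open>w - i\<close> and \<open>- w - i\<close> squares at level \<open>n + 2\<close>. The two signs cancel in the product.
\<close>

lemma square_root_cubic_E_in_splitK:
  assumes z: "z \<in> iterate_roots n" and n: "n > 0" "n + 2 \<le> m"
  shows "\<exists>y \<in> splitK m. y ^ 2 = poly cubic_E z"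
proof -
  define w where "w = csqrt (z - \<i>)"
  define u where "u = csqrt (- z - \<i>)"
  define s where "s = csqrt (w - \<i>)"
  define t where "t = csqrt (- w - \<i>)"
  have w: "w \<in> iterate_roots (Suc n)" and u: "u \<in> iterate_roots (Suc n)"
    unfolding w_def u_def using z n(1) uminus_in_iterate_roots csqrt_in_iterate_roots by auto
  then have "s \<in> iterate_roots (Suc (Suc n))" "t \<in> iterate_roots (Suc (Suc n))"
    unfolding s_def t_def using uminus_in_iterate_roots[OF w] csqrt_in_iterate_roots by auto
  then have "w \<in> splitK m" "u \<in> splitK m" "s \<in> splitK m" "t \<in> splitK m"
    using w u n(2) iterate_roots_subset_splitK[of "Suc n" m] iterate_roots_subset_splitK[of "Suc (Suc n)" m]
    by auto
  then have "w * u * s * t \<in> splitK m"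
    using splitK_closed(3) by blast
  moreover have "(w * u * s * t) ^ 2 = poly cubic_E z"
  proof -
    have "w ^ 2 = z - \<i>" "u ^ 2 = - z - \<i>" "s ^ 2 = w - \<i>" "t ^ 2 = - w - \<i>"
      by (simp_all add: w_def u_def s_def t_def)
    then have "(w * u * s * t) ^ 2 = (z - \<i>) * (- z - \<i>) * ((w - \<i>) * (- w - \<i>))"
      by (simp only: power_mult_distrib mult.assoc)
    also have "(w - \<i>) * (- w - \<i>) = - (w ^ 2) - 1"
      by (simp add: algebra_simps power2_eq_square)
    also have "w ^ 2 = z - \<i>" by fact
    finally show ?thesis
      unfolding poly_cubic_E by (simp add: algebra_simps)
  qed
  ultimately show ?thesis by blast
qed

text \<open>
  A backward orbit of \<open>0\<close> under \<^const>\<open>f2i\<close>.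
\<close>

primrec beta :: "nat \<Rightarrow> complex" where
  "beta 0 = 0"
| "beta (Suc n) = csqrt (beta n - \<i>)"

lemma beta_in_iterate_roots: "beta n \<in> iterate_roots n"
  by (induction n) (auto intro: csqrt_in_iterate_roots simp: iterate_roots_def[of 0])

lemma beta_Suc_power2: "beta (Suc n) ^ 2 = beta n - \<i>"
  by simp

text \<open>
  At even level the preimages are the small ones: modulo \<open>1 - i\<close> the map \<^const>\<open>f2i\<close> exchanges \<open>0\<close> and \<open>1\<close>.
\<close>

abbreviation eps :: "nat \<Rightarrow> complex" where
  "eps k \<equiv> beta (2 * k)"

lemma eps_Suc: "eps (Suc k) ^ 2 * (eps (Suc k) ^ 2 + 2 * \<i>) = eps k + (1 - \<i>)"
proof -
  have "(eps (Suc k) ^ 2 + \<i>) ^ 2 = eps k - \<i>"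
    using beta_Suc_power2[of "2 * k"] beta_Suc_power2[of "Suc (2 * k)"] by simp
  then show ?thesis
    by (simp add: power2_eq_square algebra_simps)
qed

lemma odd_times_power_eq:
  assumes "(E :: nat) * 4 ^ i = F * 4 ^ j" "odd E" "odd F"
  shows "i = j \<and> E = F"
proof -
  have *: "i \<ge> j" if "E * 4 ^ i = F * 4 ^ j" "odd E" for E F i j :: nat
  proof (rule ccontr)
    assume "\<not> i \<ge> j"
    then have "(4 :: nat) ^ j = 4 ^ (j - i) * 4 ^ i" by (simp flip: power_add)
    then have "E = F * 4 ^ (j - i)" using that(1) by simp
    then show False using \<open>\<not> i \<ge> j\<close> that(2) by simp
  qed
  have "i = j" using *[of E i F j] *[of F j E i] assms by simp
  then show ?thesis using assms(1) by simp
qed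

text \<open>
  The prime \<open>1 - i\<close> above \<open>2\<close> serves as the unit of measurement: \<open>2\<close> and \<open>4\<close> have the size of its
  second and fourth power.
\<close>

locale dyadic_valuation_ring = valuation_ring V for V :: "complex set" +
  assumes two_max_ideal: "2 \<in> max_ideal"
begin

abbreviation uniformizer :: complex ("\<pi>") where
  "\<pi> \<equiv> 1 - \<i>"

lemma i_mem [simp, intro]: "\<i> \<in> V"
  using total[of \<i>] by simp

lemma pi_power2: "\<pi> ^ 2 = - 2 * \<i>"
  by (simp add: power2_eq_square algebra_simps)

lemma two_sim_pi: "2 \<approx> \<pi> ^ 2"
  unfolding pi_power2 by (simp add: sim_def)

lemma pi_max_ideal: "\<pi> \<in> max_ideal"
  using power_max_ideal_imp[of \<pi> 2] sim_max_ideal[OF two_sim_pi two_max_ideal] by simp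

lemma pi_nonzero: "\<pi> \<noteq> 0"
  by (simp add: complex_eq_iff)

lemma four_sim_pi: "4 \<approx> \<pi> ^ 4"
  using sim_mult[OF two_sim_pi two_sim_pi] by (simp flip: power_add)

lemma two_div_pi: "2 / \<pi> \<in> max_ideal"
proof -
  have "2 / \<pi> \<approx> \<pi> ^ 2 / \<pi>"
    by (intro sim_divide two_sim_pi sim_refl pi_nonzero)
  moreover have "\<pi> ^ 2 / \<pi> = \<pi>" using pi_nonzero by (simp add: power2_eq_square)
  ultimately show ?thesis using sim_max_ideal sim_sym pi_max_ideal by metis
qed

text \<open>
  The equation has the shape \<open>z\<^sup>4 + 2 i z\<^sup>2 = s\<close> of the recursion for \<open>eps\<close>. Were \<open>z\<^sup>2\<close> at most as large as \<open>2\<close>,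
  then so would be \<open>s\<close>; hence \<open>z\<^sup>4\<close> is the dominant term.
\<close>

lemma quartic_root_sim:
  assumes eq: "z ^ 2 * (z ^ 2 + 2 * \<i>) = s" and s: "s \<noteq> 0" "2 / s \<in> max_ideal"
  shows "z ^ 4 \<approx> s"
proof -
  have "z \<noteq> 0" using eq s(1) by auto
  have "z ^ 2 / 2 \<notin> V"
  proof
    assume q: "z ^ 2 / 2 \<in> V"
    have "s / 2 = (z ^ 2 / 2) * (2 * (z ^ 2 / 2) + 2 * \<i>)"
      using eq by simp
    also have "\<dots> \<in> V" using q by (intro mult_mem add_mem) auto
    finally have "s / 2 \<in> V" .
    then have "s / 2 * (2 / s) \<in> max_ideal" using s(2) by (intro max_ideal_mult)
    then show False using s(1) by simp
  qed
  then have "2 / z ^ 2 \<in> max_ideal"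
    using not_mem_imp_inverse_max_ideal by fastforce
  then have "2 * \<i> / z ^ 2 \<in> max_ideal"
    using max_ideal_mult(1)[of "2 / z ^ 2" \<i>] by simp
  then have "z ^ 2 + 2 * \<i> \<approx> z ^ 2"
    using \<open>z \<noteq> 0\<close> by (intro sim_add) auto
  then have "z ^ 2 * (z ^ 2 + 2 * \<i>) \<approx> z ^ 2 * z ^ 2"
    using \<open>z \<noteq> 0\<close> by (intro sim_mult sim_refl) auto
  then show ?thesis
    unfolding eq using sim_sym by (simp flip: power_add)
qed

lemma small_root:
  assumes "z ^ (4 ^ k) \<approx> \<pi>" "k > 0"
  shows "z \<in> max_ideal" "z \<noteq> 0" "\<pi> / z \<in> max_ideal" "2 / z \<in> max_ideal"
proof -
  show z: "z \<in> max_ideal"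
    using power_max_ideal_imp sim_max_ideal[OF sim_sym[OF assms(1)] pi_max_ideal] by blast
  show "z \<noteq> 0" using assms(1) by (auto simp: sim_def)
  have "(4 :: nat) ^ k > 1" using assms(2) one_less_power[of "4 :: nat" k] by simp
  then have "z ^ (4 ^ k) = z ^ (4 ^ k - 1) * z"
    by (simp flip: power_Suc2)
  then have "z ^ (4 ^ k) / z = z ^ (4 ^ k - 1)" using \<open>z \<noteq> 0\<close> by simp
  moreover have "z ^ (4 ^ k - 1) \<in> max_ideal"
    using z \<open>(4 :: nat) ^ k > 1\<close> by (intro max_ideal_power) auto
  moreover have "z ^ (4 ^ k) / z \<approx> \<pi> / z"
    using assms(1) \<open>z \<noteq> 0\<close> by (intro sim_divide sim_refl)
  ultimately show pi: "\<pi> / z \<in> max_ideal" using sim_max_ideal by metis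
  have "2 / \<pi> * (\<pi> / z) \<in> max_ideal"
    using pi two_div_pi by (intro max_ideal_mult max_ideal_mem)
  moreover have "2 / p * (p / z) = 2 / z" if "p \<noteq> 0" for p
    using that by simp
  note this[OF pi_nonzero]
  ultimately show "2 / z \<in> max_ideal" by metis
qed

text \<open>
  In additive notation, \<open>v (eps k) = v \<pi> / 4\<^sup>k\<close>. The recursion takes a fourth root up to the perturbation \<open>\<pi>\<close>,
  which starts the sequence at \<open>eps 0 = 0\<close> and is negligible afterwards.
\<close>

lemma eps_sim_pi: "k > 0 \<Longrightarrow> eps k ^ (4 ^ k) \<approx> \<pi>"
proof (induction k rule: nat_induct_non_zero)
  case 1
  have "eps (Suc 0) ^ 4 \<approx> \<pi>"
    using quartic_root_sim[OF eps_Suc[of 0]] two_div_pi pi_nonzero by simp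
  then show ?case by simp
next
  case (Suc k)
  note small = small_root[OF Suc.IH \<open>0 < k\<close>]
  have s: "eps k + \<pi> \<approx> eps k"
    using small by (intro sim_add)
  have "2 / eps k \<approx> 2 / (eps k + \<pi>)"
    by (intro sim_divide sim_refl sim_sym[OF s]) simp
  then have "2 / (eps k + \<pi>) \<in> max_ideal"
    using small(4) sim_max_ideal by blast
  then have "eps (Suc k) ^ 4 \<approx> eps k + \<pi>"
    using quartic_root_sim[OF eps_Suc[of k]] s by (auto simp: sim_def)
  then have "(eps (Suc k) ^ 4) ^ (4 ^ k) \<approx> eps k ^ (4 ^ k)"
    by (intro sim_power sim_trans[OF _ s])
  also note Suc.IH
  finally show ?case by (simp add: power_mult flip: power_mult)
qed

sublocale C: cubic_over_valuation_ring "1 - \<i>" 1 "1 - \<i>" cubic_E V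
proof unfold_locales
  show "poly (pderiv cubic_E) x \<noteq> 0" if "poly cubic_E x = 0" for x
    using cubic_E_separable that by blast
qed (auto simp: cubic_E_coeffs two_max_ideal)

text \<open>
  In the duplication formula \<open>4 f(x) x' = f'(x)\<^sup>2 - 4 f(x) (a + 2 x)\<close> the square dominates as soon as
  \<open>4 f(x)\<close> is smaller than \<open>f'(x)\<^sup>2\<close>. So although \<open>x\<close> itself is integral, doubling moves the point
  close to infinity.
\<close>

lemma has_depth_double_dominant:
  assumes P: "Affine x y \<in> C.points" and u: "poly cubic_E x \<approx> u"
    and v: "poly (pderiv cubic_E) x \<approx> v" and small: "4 * u / v ^ 2 \<in> max_ideal" and "x \<in> V"
  shows "C.has_depth (ec_add cubic_E (Affine x y) (Affine x y)) (4 * u / v ^ 2)"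
proof (rule C.has_depth_double_affine[OF P u])
  let ?D = "poly (pderiv cubic_E) x ^ 2" and ?f = "poly cubic_E x"
  have D: "?D \<approx> v ^ 2" using v by (rule sim_power)
  have "4 * ?f / ?D \<approx> 4 * u / v ^ 2"
    by (intro sim_divide[OF sim_mult[OF sim_refl u] D]) simp
  then have "4 * ?f / ?D \<in> max_ideal"
    using sim_max_ideal[OF sim_sym] small by blast
  then have "4 * ?f / ?D * - (\<pi> + 2 * x) \<in> max_ideal"
    using \<open>x \<in> V\<close> by (intro max_ideal_mult(1)) auto
  moreover have "A / D * - B = - (A * B) / D" for A B D :: complex
    by simp
  note this[of "4 * ?f" ?D "\<pi> + 2 * x"]
  ultimately have "- (4 * ?f * (\<pi> + 2 * x)) / ?D \<in> max_ideal"
    by metis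
  then have "?D + - (4 * ?f * (\<pi> + 2 * x)) \<approx> ?D"
    using D by (intro sim_add) (auto simp: sim_def)
  from sim_trans[OF this D] show "?D - 4 * ?f * (\<pi> + 2 * x) \<approx> v ^ 2"
    by simp
qed

text \<open>
  Here \<open>f'(x)\<close> is a unit and \<open>f(x) \<approx> x\<close>, because only the factor \<open>x + 1 - i\<close> is small.
\<close>

lemma has_depth_even:
  assumes "k > 0" and P: "Affine (eps k) y \<in> C.points"
  shows "C.has_depth (ec_add cubic_E (Affine (eps k) y) (Affine (eps k) y)) (4 * eps k)"
proof -
  let ?z = "eps k"
  note small = small_root[OF eps_sim_pi[OF \<open>k > 0\<close>] \<open>k > 0\<close>]
  note zV = max_ideal_mem[OF small(1)]
  have "poly cubic_E ?z = (?z ^ 2 + 1) * (?z + \<pi>)"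
    by (simp add: poly_cubic_E algebra_simps power2_eq_square)
  also have "\<dots> \<approx> 1 * ?z"
    using small one_add_max_ideal[of "?z ^ 2"] max_ideal_power[of ?z 2]
    by (intro sim_mult sim_add) (auto simp: add.commute)
  finally have f: "poly cubic_E ?z \<approx> ?z" by simp
  have "3 * ?z + 2 * \<pi> \<in> V" using zV by auto
  then have "?z * (3 * ?z + 2 * \<pi>) \<in> max_ideal"
    using small(1) by (intro max_ideal_mult)
  moreover have "poly (pderiv cubic_E) ?z = 1 + ?z * (3 * ?z + 2 * \<pi>)"
    unfolding C.poly_pderiv_f by (simp add: algebra_simps power2_eq_square)
  ultimately have d: "poly (pderiv cubic_E) ?z \<approx> 1"
    using one_add_max_ideal by metis
  have "4 * ?z / 1 ^ 2 \<in> max_ideal"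
    using max_ideal_mult(2)[OF small(1), of 4] by simp
  from has_depth_double_dominant[OF P f d this zV] show ?thesis by simp
qed

text \<open>
  Here \<open>x\<close> is a unit with \<open>x\<^sup>2 + 1 = eps k + 1 - i\<close> small, and both \<open>f(x)\<close> and \<open>f'(x)\<close> have the size of
  \<open>eps k\<close>.
\<close>

lemma has_depth_odd:
  assumes "k > 0" and P: "Affine (beta (2 * k + 1)) y \<in> C.points"
  shows "C.has_depth (ec_add cubic_E (Affine (beta (2 * k + 1)) y) (Affine (beta (2 * k + 1)) y)) (4 / eps k)"
proof -
  let ?e = "eps k" and ?x = "beta (2 * k + 1)"
  note small = small_root[OF eps_sim_pi[OF \<open>k > 0\<close>] \<open>k > 0\<close>]
  have x2: "?x ^ 2 = ?e - \<i>" by simp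
  have "?e / - \<i> \<in> max_ideal"
    using max_ideal_mult(2)[OF small(1), of \<i>] by simp
  then have "- \<i> + ?e \<approx> - \<i>" by (intro sim_add) auto
  then have "?x ^ 2 \<approx> - \<i>" unfolding x2 by (simp add: algebra_simps)
  also have "- \<i> \<approx> 1" by (simp add: sim_def)
  finally have x2_unit: "?x ^ 2 \<approx> 1" .
  have x_unit: "?x \<approx> 1"
  proof -
    have "?x \<noteq> 0" using x2_unit by (auto simp: sim_def)
    moreover have "?x \<notin> max_ideal"
      using sim_max_ideal[OF x2_unit] max_ideal_power[of ?x 2] by auto
    moreover have "inverse ?x \<notin> max_ideal"
    proof
      assume "inverse ?x \<in> max_ideal"
      then have "inverse (?x ^ 2) \<in> max_ideal"
        using max_ideal_power[of "inverse ?x" 2] by (simp add: power_inverse)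
      then show False
        using sim_max_ideal[OF C.sim_inverse[OF x2_unit]] by simp
    qed
    ultimately show ?thesis
      using sim_trichotomy[of ?x 1] by (auto simp: field_class.field_divide_inverse)
  qed
  have xV: "?x \<in> V" using sim_mem[OF sim_sym[OF x_unit]] by simp
  have e: "?x ^ 2 + 1 \<approx> ?e"
  proof -
    have "?e + \<pi> \<approx> ?e" using small by (intro sim_add)
    then show ?thesis unfolding x2 by (simp add: algebra_simps)
  qed
  have "poly cubic_E ?x = (?x ^ 2 + 1) * (?x + \<pi>)"
    by (simp only: poly_cubic_E) (simp add: algebra_simps power2_eq_square)
  also have "\<dots> \<approx> ?e * 1"
  proof (intro sim_mult e)
    have "\<pi> / ?x \<approx> \<pi> / 1" by (intro sim_divide sim_refl x_unit pi_nonzero)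
    then have "\<pi> / ?x \<in> max_ideal" using sim_max_ideal[OF sim_sym] pi_max_ideal by auto
    then have "?x + \<pi> \<approx> ?x" using x_unit by (intro sim_add) (auto simp: sim_def)
    then show "?x + \<pi> \<approx> 1" using x_unit sim_trans by blast
  qed
  finally have f: "poly cubic_E ?x \<approx> ?e" by simp
  have "2 / (?x ^ 2 + 1) \<approx> 2 / ?e" by (intro sim_divide sim_refl e) simp
  then have "2 / (?x ^ 2 + 1) \<in> max_ideal" using sim_max_ideal[OF sim_sym] small(4) by blast
  then have "2 / (?x ^ 2 + 1) * (?x ^ 2 + \<pi> * ?x) \<in> max_ideal"
    using xV by (intro max_ideal_mult(1) add_mem mult_mem power_mem) auto
  then have "(?x ^ 2 + 1) + 2 * (?x ^ 2 + \<pi> * ?x) \<approx> ?x ^ 2 + 1"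
    using e by (intro sim_add) (auto simp: sim_def)
  moreover have "poly (pderiv cubic_E) ?x = (?x ^ 2 + 1) + 2 * (?x ^ 2 + \<pi> * ?x)"
    by (simp only: C.poly_pderiv_f) (simp add: algebra_simps)
  ultimately have d: "poly (pderiv cubic_E) ?x \<approx> ?e"
    using e sim_trans by metis
  have frac: "4 * ?e / ?e ^ 2 = 4 / ?e"
    using small(2) by (simp add: power2_eq_square)
  have "2 * (2 / ?e) \<in> max_ideal" using small(4) by (intro max_ideal_mult(2)) auto
  then have "4 * ?e / ?e ^ 2 \<in> max_ideal" unfolding frac by simp
  from has_depth_double_dominant[OF P f d this xV] show ?thesis unfolding frac .
qed

definition depth :: "nat \<Rightarrow> complex" where
  "depth n = (if even n then 4 * eps (n div 2) else 4 / eps (n div 2))"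

lemma has_depth_beta:
  assumes "n \<ge> 2" "Affine (beta n) y \<in> C.points"
  shows "C.has_depth (ec_add cubic_E (Affine (beta n) y) (Affine (beta n) y)) (depth n)"
proof (cases "even n")
  case True
  then obtain k where "n = 2 * k" by (rule evenE)
  then show ?thesis using has_depth_even[of k y] assms by (simp add: depth_def)
next
  case False
  then obtain k where "n = 2 * k + 1" by (rule oddE)
  then show ?thesis
    using has_depth_odd[of k y] assms by (simp add: depth_def del: beta.simps)
qed

lemma depth_max_ideal:
  assumes "n \<ge> 2"
  shows "depth n \<in> max_ideal"
proof -
  have k: "n div 2 > 0" using assms by simp
  note small = small_root[OF eps_sim_pi[OF k] k]
  have "4 * eps (n div 2) \<in> max_ideal" "2 * (2 / eps (n div 2)) \<in> max_ideal"
    by (intro max_ideal_mult(2) small numeral_mem)+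
  then have "4 * eps (n div 2) \<in> max_ideal" "4 / eps (n div 2) \<in> max_ideal"
    by (simp_all only: times_divide_eq_right) simp_all
  then show ?thesis
    unfolding depth_def by (cases "even n") (simp_all only: if_True if_False)
qed

text \<open>
  In additive notation, \<open>v (4\<^sup>e depth n) = 4 (e + 1) v \<pi> \<plusminus> v \<pi> / 4\<^sup>k\<close>, with the sign given by the parity of
  \<open>n\<close>. The power clears the denominator.
\<close>

lemma depth_power_sim:
  assumes "n \<ge> 2"
  defines "k \<equiv> n div 2"
  shows "(4 ^ e * depth n) ^ (4 ^ k)
    \<approx> \<pi> ^ (if even n then 4 * ((e + 1) * 4 ^ k) + 1 else 4 * ((e + 1) * 4 ^ k) - 1)"
proof -
  have k: "k > 0" using assms by simp
  let ?N = "(e + 1) * 4 ^ k :: nat"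
  have "?N > 0" by simp
  have four: "(4 ^ (e + 1)) ^ (4 ^ k) \<approx> \<pi> ^ (4 * ?N)"
    using sim_power[OF four_sim_pi, of ?N] by (simp only: power_mult flip: power_mult)
  show ?thesis
  proof (cases "even n")
    case True
    have "(4 ^ (e + 1)) ^ (4 ^ k) * eps k ^ (4 ^ k) \<approx> \<pi> ^ (4 * ?N) * \<pi>"
      by (intro sim_mult four eps_sim_pi k)
    then show ?thesis
      using True by (simp add: depth_def k_def power_mult_distrib mult_ac)
  next
    case False
    have "(4 ^ (e + 1)) ^ (4 ^ k) / eps k ^ (4 ^ k) \<approx> \<pi> ^ (4 * ?N) / \<pi>"
      by (intro sim_divide four eps_sim_pi k)
    moreover have "\<pi> ^ (4 * ?N) = \<pi> ^ (4 * ?N - 1) * \<pi>"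
      using \<open>?N > 0\<close> by (simp flip: power_Suc2)
    ultimately have "(4 ^ (e + 1)) ^ (4 ^ k) / eps k ^ (4 ^ k) \<approx> \<pi> ^ (4 * ?N - 1)"
      using pi_nonzero by simp
    moreover have "(4 ^ e * depth n) ^ (4 ^ k) = (4 ^ (e + 1)) ^ (4 ^ k) / eps k ^ (4 ^ k)"
      using False by (simp add: depth_def k_def power_divide power_mult_distrib mult_ac)
    ultimately show ?thesis using False by simp
  qed
qed

text \<open>
  The reduced fraction \<open>E / 4\<^sup>k\<close> with odd \<open>E\<close> determines \<open>k = n div 2\<close>, and \<open>E\<close> modulo \<open>4\<close> determines the
  parity of \<open>n\<close>.
\<close>

lemma depth_separated:
  assumes n: "n \<ge> 2" "n' \<ge> 2" and sim: "4 ^ e * depth n \<approx> 4 ^ e' * depth n'"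
  shows "n = n'"
proof -
  define k k' where "k = n div 2" and "k' = n' div 2"
  define E where "E n e = (if even n then 4 * ((e + 1) * 4 ^ (n div 2)) + 1
    else 4 * ((e + 1) * 4 ^ (n div 2)) - 1)" for n e :: nat
  have mod4: "E n e mod 4 = (if even n then 1 else 3)" for n e
  proof -
    obtain j where "(e + 1) * 4 ^ (n div 2) = Suc j"
      using not0_implies_Suc[of "(e + 1) * 4 ^ (n div 2)"] by auto
    then show ?thesis unfolding E_def by simp
  qed
  have odd: "odd (E n e)" for n e
  proof -
    have "E n e mod 4 = 1 \<or> E n e mod 4 = 3" using mod4[of n e] by simp
    then show ?thesis by presburger
  qed
  have "\<pi> ^ (E n e * 4 ^ k') \<approx> ((4 ^ e * depth n) ^ (4 ^ k)) ^ (4 ^ k')"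
    unfolding power_mult E_def k_def by (intro sim_power sim_sym[OF depth_power_sim] n)
  also have "\<dots> = (4 ^ e * depth n) ^ (4 ^ k * 4 ^ k')"
    by (rule power_mult[symmetric])
  also have "\<dots> \<approx> (4 ^ e' * depth n') ^ (4 ^ k * 4 ^ k')"
    by (intro sim_power sim)
  also have "\<dots> = ((4 ^ e' * depth n') ^ (4 ^ k')) ^ (4 ^ k)"
    by (subst mult.commute) (rule power_mult)
  also have "\<dots> \<approx> \<pi> ^ (E n' e' * 4 ^ k)"
    unfolding power_mult E_def k'_def by (intro sim_power depth_power_sim n)
  finally have "E n e * 4 ^ k' = E n' e' * 4 ^ k"
    by (rule sim_powers_eq[OF pi_max_ideal pi_nonzero])
  then have eq: "k' = k \<and> E n e = E n' e'"
    by (rule odd_times_power_eq) (rule odd)+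
  have parity: "even n = even n'"
  proof -
    have "(if even n then 1 else 3) = (if even n' then 1 else 3 :: nat)"
      unfolding mod4[symmetric, of n e] mod4[symmetric, of n' e'] using eq by metis
    then show ?thesis by presburger
  qed
  have "n div 2 = n' div 2"
    using eq unfolding k_def k'_def by metis
  with parity show ?thesis by presburger
qed

end

text \<open>
  The levels \<open>2 \<le> n \<le> m - 2\<close> contribute one point each: below \<open>2\<close> the relevant \<open>eps k\<close> is \<open>eps 0 = 0\<close>,
  above \<open>m - 2\<close> the \<open>Y\<close>-coordinate need not lie in \<open>splitK m\<close>.
\<close>

lemma rank_lower_bound:
  assumes "m \<ge> 3"
  shows "enat (m - 3) \<le> abelian_rank (ec_group cubic_E (splitK m))"
proof -
  have "unital_subring (\<int> :: complex set)" by unfold_locales auto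
  moreover have "inverse 2 \<notin> (\<int> :: complex set)"
  proof
    assume "inverse 2 \<in> (\<int> :: complex set)"
    then obtain j where "inverse 2 = (of_int j :: complex)" by (auto elim: Ints_cases)
    then have "of_int (2 * j) = (of_int 1 :: complex)" by (simp add: field_simps)
    then have "2 * j = 1" by (simp only: of_int_eq_iff)
    then show False by presburger
  qed
  moreover have "2 \<in> (\<int> :: complex set)" by simp
  ultimately obtain V :: "complex set" where V: "valuation_ring V" "\<int> \<subseteq> V" "inverse 2 \<notin> V"
    using exists_valuation_ring[of "\<int> :: complex set" 2] by blast
  then have "2 \<in> valuation_ring.max_ideal V"
    by (auto simp: valuation_ring.max_ideal_def)
  with V(1) interpret dyadic_valuation_ring V
    by (intro dyadic_valuation_ring.intro dyadic_valuation_ring_axioms.intro)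
  have "1 - \<i> \<in> splitK m" "1 \<in> splitK m"
    using splitK_closed(1,4) i_in_splitK by blast+
  then interpret G: curve_group "1 - \<i>" 1 "1 - \<i>" cubic_E V "splitK m"
    by (intro curve_group.intro curve_group_axioms.intro C.cubic_over_valuation_ring_axioms
        splitK_subfield)
  define y where "y n = (SOME y. y \<in> splitK m \<and> y ^ 2 = poly cubic_E (beta n))" for n
  define P where "P n = Affine (beta n) (y n)" for n
  have P: "P n \<in> carrier (ec_group cubic_E (splitK m))" if "n \<in> {2..m - 2}" for n
  proof -
    have "n > 0" "n + 2 \<le> m" using that by auto
    then have "\<exists>y. y \<in> splitK m \<and> y ^ 2 = poly cubic_E (beta n)"
      using square_root_cubic_E_in_splitK[OF beta_in_iterate_roots] by blast
    from someI_ex[OF this] have "y n \<in> splitK m" "y n ^ 2 = poly cubic_E (beta n)"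
      by (auto simp: y_def)
    moreover have "beta n \<in> splitK m"
      using iterate_roots_subset_splitK[OF _ beta_in_iterate_roots, of n m] that by auto
    ultimately show ?thesis by (simp add: P_def ec_group_def)
  qed
  have "enat (card {2..m - 2}) \<le> abelian_rank (ec_group cubic_E (splitK m))"
  proof (rule G.abelian_rank_ge[where Q = "\<lambda>n. ec_add cubic_E (P n) (P n)" and w = depth])
    fix n assume n: "n \<in> {2..m - 2}"
    show "ec_add cubic_E (P n) (P n) \<in> carrier (ec_group cubic_E (splitK m))"
      using G.E.m_closed[OF P[OF n] P[OF n]] by (simp add: G.mult_eq)
    have "Affine (beta n) (y n) \<in> C.points"
      using P[OF n] unfolding P_def by (rule G.carrier_points)
    then show "C.has_depth (ec_add cubic_E (P n) (P n)) (depth n) \<and> depth n \<in> max_ideal"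
      using has_depth_beta[of n "y n"] depth_max_ideal[of n] n unfolding P_def by simp
  next
    fix i j e e' assume "i \<in> {2..m - 2}" "j \<in> {2..m - 2}" "sim (4 ^ e * depth i) (4 ^ e' * depth j)"
    then show "i = j" using depth_separated[of i j e e'] by simp
  qed simp
  moreover have "card {2..m - 2} = m - 3" using assms by simp
  ultimately show ?thesis by simp
qed

section \<open>The rank bound\<close>

theorem proposition5p13:
  fixes m :: nat
  assumes "m \<ge> 3"
  shows "ereal_of_enat (abelian_rank (ec_group cubic_E (splitK m)))
           \<ge> ereal ((real m * ln 2 - ln (256 * 10 ^ 13)) / (2 * ln (1 + 5 / (4 * sqrt 2))))"
proof -
  let ?r = "(real m * ln 2 - ln (256 * 10 ^ 13)) / (2 * ln (1 + 5 / (4 * sqrt 2)))"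
  \<comment> \<open>The bound \<open>m - 3\<close> suffices: already \<open>ln 2\<close> in the denominator and \<open>3 ln 2\<close> in place of the
    subtracted constant give exactly \<open>m - 3\<close>.\<close>
  have "sqrt 2 \<le> 2"
    by (rule real_le_lsqrt) auto
  then have "5 / (4 * sqrt 2) \<ge> 5 / (4 * 2)"
    by (intro divide_left_mono) auto
  then have "(1 + 5 / 8) ^ 2 \<le> (1 + 5 / (4 * sqrt 2)) ^ 2"
    by (intro power_mono) auto
  then have "2 \<le> (1 + 5 / (4 * sqrt 2)) ^ 2"
    by (simp add: power2_eq_square)
  then have "ln 2 \<le> ln ((1 + 5 / (4 * sqrt 2)) ^ 2)"
    by (intro ln_mono) auto
  also have "\<dots> = 2 * ln (1 + 5 / (4 * sqrt 2))"
    by (subst ln_realpow) (auto intro: add_pos_nonneg)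
  finally have denom: "ln 2 \<le> 2 * ln (1 + 5 / (4 * sqrt 2))" .
  have "3 * ln 2 = ln (2 ^ 3 :: real)"
    by (subst ln_realpow) auto
  also have "\<dots> \<le> ln (256 * 10 ^ 13)"
    by (intro ln_mono) auto
  finally have "real m * ln 2 - ln (256 * 10 ^ 13) \<le> (real m - 3) * ln 2"
    by (simp add: algebra_simps)
  also have "\<dots> \<le> (real m - 3) * (2 * ln (1 + 5 / (4 * sqrt 2)))"
    using assms denom by (intro mult_left_mono) auto
  finally have "real m * ln 2 - ln (256 * 10 ^ 13) \<le> (real m - 3) * (2 * ln (1 + 5 / (4 * sqrt 2)))" .
  moreover have "0 < 2 * ln (1 + 5 / (4 * sqrt 2))"
    using denom ln_gt_zero[of "2 :: real"] by linarith
  ultimately have "?r \<le> real (m - 3)"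
    using assms by (simp only: pos_divide_le_eq of_nat_diff of_nat_numeral)
  then have "ereal ?r \<le> ereal_of_enat (enat (m - 3))"
    by simp
  also have "\<dots> \<le> ereal_of_enat (abelian_rank (ec_group cubic_E (splitK m)))"
    using rank_lower_bound[OF assms] by (simp only: ereal_of_enat_le_iff)
  finally show ?thesis .
qed

end
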